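(* The operation $\otimes_\varphi$ is non-commutative in the following sense: there exist integers $n,m\ge2$ and unitary representations $\pi_1$ of $\mathbb F_n$ and $\pi_2$ of $\mathbb F_m$ such that $\pi_1\otimes_\varphi\pi_2$ and $\pi_2\otimes_\varphi\pi_1$ (both unitary representations of $\mathbb F_{nm}$) are not unitarily equivalent.
   Context: $\mathbb F_n$ is the free group of rank $n$ with free generators $g^{(n)}_1,\dots,g^{(n)}_n$. For $n,m\ge1$, $\phi_{n,m}:\mathbb F_{nm}\to\mathbb F_n\times\mathbb F_m$ is the group homomorphism with $\phi_{n,m}(g^{(nm)}_{m(i-1)+j})=(g^{(n)}_i,g^{(m)}_j)$ for $1\le i\le n$, $1\le j\le m$. For unitary representations $\pi$ of $\mathbb F_n$ and $\pi'$ of $\mathbb F_m$, $\pi\otimes_\varphi\pi'$ is the unitary representation of $\mathbb F_{nm}$ defined by $\pi\otimes_\varphi\pi':=(\pi\otimes\pi')\circ\varphi_{n,m}$, where $\varphi_{n,m}:C^*(\mathbb F_{nm})\to C^*(\mathbb F_n)\otimes C^*(\mathbb F_m)$ is the unital $*$-homomorphism of full group C$^*$-algebras (minimal tensor product) with $\varphi_{n,m}(g^{(nm)}_{m(i-1)+j})=g^{(n)}_i\otimes g^{(m)}_j$; that is, $(\pi\otimes_\varphi\pi')(g)=\pi(g')\otimes\pi'(g'')$ with $(g',g'')=\phi_{n,m}(g)$. *)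

theory Defs
  imports "HOL-Algebra.Algebra" "HOL-Analysis.Abstract_Metric_Spaces" "HOL-Library.Poly_Mapping"
begin

section \<open>Free groups\<close>

text \<open>The letter \<open>(True, i)\<close> stands for the generator with index \<open>i\<close> and \<open>(False, i)\<close> for its
  inverse. The elements of the free group are the reduced words.\<close>

type_synonym letter = "bool \<times> nat"

definition inv_letter :: "letter \<Rightarrow> letter" where
  "inv_letter x = (\<not> fst x, snd x)"

definition reduced :: "letter list \<Rightarrow> bool" where
  "reduced w \<longleftrightarrow> successively (\<lambda>x y. y \<noteq> inv_letter x) w"

fun push_letter :: "letter \<Rightarrow> letter list \<Rightarrow> letter list" where
  "push_letter x [] = [x]"
| "push_letter x (y # w) = (if y = inv_letter x then w else x # y # w)"

text \<open>Multiplication is concatenation followed by free reduction.\<close>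

definition free_group :: "nat \<Rightarrow> letter list monoid" where
  "free_group n = \<lparr>carrier = {w. reduced w \<and> snd ` set w \<subseteq> {1..n}},
     monoid.mult = (\<lambda>u v. foldr push_letter u v), one = []\<rparr>"

definition free_gen :: "nat \<Rightarrow> letter list" where
  "free_gen i = [(True, i)]"

text \<open>The extension to words of a map from the generators to a group.\<close>

definition free_lift :: "('g, 'm) monoid_scheme \<Rightarrow> (nat \<Rightarrow> 'g) \<Rightarrow> letter list \<Rightarrow> 'g" where
  "free_lift G f w =
     foldr (\<lambda>x z. (if fst x then f (snd x) else inv\<^bsub>G\<^esub> (f (snd x))) \<otimes>\<^bsub>G\<^esub> z) w \<one>\<^bsub>G\<^esub>"

lemma inv_letter_inv_letter [simp]: "inv_letter (inv_letter x) = x"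
  by (simp add: inv_letter_def)

lemma snd_inv_letter [simp]: "snd (inv_letter x) = snd x"
  by (simp add: inv_letter_def)

lemma inv_letter_neq [simp]: "inv_letter x \<noteq> x"
  by (cases x) (simp add: inv_letter_def)

lemma reduced_Nil [simp]: "reduced []"
  by (simp add: reduced_def)

lemma reduced_ConsD: "reduced (x # w) \<Longrightarrow> reduced w"
  by (cases w) (auto simp: reduced_def)

lemma reduced_push_letter: "reduced w \<Longrightarrow> reduced (push_letter x w)"
  by (cases w) (auto simp: reduced_def intro: reduced_ConsD[unfolded reduced_def])

lemma set_push_letter: "set (push_letter x w) \<subseteq> insert x (set w)"
  by (cases w) auto

lemma push_inv_push_letter: "reduced w \<Longrightarrow> push_letter (inv_letter x) (push_letter x w) = w"
  by (cases w rule: remdups_adj.cases) (auto simp: reduced_def)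

lemma push_push_inv_letter: "reduced w \<Longrightarrow> push_letter x (push_letter (inv_letter x) w) = w"
  using push_inv_push_letter[of w "inv_letter x"] by simp

lemma push_letter_reduced: "reduced (x # w) \<Longrightarrow> push_letter x w = x # w"
  by (cases w) (auto simp: reduced_def)

lemma reduced_foldr_push: "reduced v \<Longrightarrow> reduced (foldr push_letter u v)"
  by (induction u) (auto simp: reduced_push_letter)

lemma set_foldr_push: "set (foldr push_letter u v) \<subseteq> set u \<union> set v"
proof (induction u)
  case (Cons x u)
  then show ?case using set_push_letter[of x "foldr push_letter u v"] by auto
qed simp

lemma foldr_push_Nil: "reduced u \<Longrightarrow> foldr push_letter u [] = u"
proof (induction u)
  case (Cons x u)
  then show ?case using reduced_ConsD push_letter_reduced by fastforce
qed simp

lemma foldr_push_push: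
  assumes "reduced w"
  shows "foldr push_letter (push_letter x v) w = push_letter x (foldr push_letter v w)"
proof (cases v)
  case (Cons y v')
  then show ?thesis
    using push_push_inv_letter reduced_foldr_push assms by auto
qed simp

lemma foldr_push_assoc:
  assumes "reduced w"
  shows "foldr push_letter (foldr push_letter u v) w = foldr push_letter u (foldr push_letter v w)"
  by (induction u) (simp_all add: foldr_push_push assms)

lemma foldr_push_rev_inv:
  "foldr push_letter (rev (map inv_letter w)) (foldr push_letter w v) = v" if "reduced v"
  using that by (induction w) (simp_all add: push_inv_push_letter reduced_foldr_push)

theorem group_free_group: "group (free_group n)"
proof (rule groupI)
  fix x y assume "x \<in> carrier (free_group n)" "y \<in> carrier (free_group n)"
  then show "x \<otimes>\<^bsub>free_group n\<^esub> y \<in> carrier (free_group n)"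
    using set_foldr_push[of x y] by (fastforce simp: free_group_def reduced_foldr_push)
next
  fix x assume x: "x \<in> carrier (free_group n)"
  define y where "y = foldr push_letter (rev (map inv_letter x)) []"
  have "foldr push_letter y x = []"
    using x foldr_push_rev_inv[of "[]" x] unfolding y_def
    by (auto simp: foldr_push_assoc free_group_def foldr_push_Nil)
  moreover have "y \<in> carrier (free_group n)"
    using set_foldr_push[of "rev (map inv_letter x)" "[]"] x
    unfolding y_def by (fastforce simp: free_group_def intro: reduced_foldr_push)
  ultimately show "\<exists>y\<in>carrier (free_group n). y \<otimes>\<^bsub>free_group n\<^esub> x = \<one>\<^bsub>free_group n\<^esub>"
    by (auto simp: free_group_def)
qed (auto simp: free_group_def foldr_push_assoc)

lemma free_gen_closed: "1 \<le> i \<Longrightarrow> i \<le> n \<Longrightarrow> free_gen i \<in> carrier (free_group n)"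
  by (auto simp: free_gen_def free_group_def reduced_def)

context
  fixes G :: "('g, 'm) monoid_scheme" and f :: "nat \<Rightarrow> 'g" and n :: nat
  assumes G: "group G" and f: "\<And>i. 1 \<le> i \<Longrightarrow> i \<le> n \<Longrightarrow> f i \<in> carrier G"
begin

interpretation group G by (rule G)

private lemma lift_closed: "snd ` set w \<subseteq> {1..n} \<Longrightarrow> free_lift G f w \<in> carrier G"
  using f by (induction w) (auto simp: free_lift_def)

private lemma lift_push:
  assumes "snd ` set (x # w) \<subseteq> {1..n}"
  shows "free_lift G f (push_letter x w) = free_lift G f [x] \<otimes>\<^bsub>G\<^esub> free_lift G f w"
proof (cases w)
  case Nil
  then show ?thesis using assms f by (auto simp: free_lift_def)
next
  case (Cons y v)
  have c: "f (snd x) \<in> carrier G" "free_lift G f v \<in> carrier G" "free_lift G f w \<in> carrier G"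
    using assms f lift_closed[of v] lift_closed[of w] by (auto simp: Cons)
  show ?thesis
  proof (cases "y = inv_letter x")
    case True
    have "free_lift G f w = free_lift G f [y] \<otimes>\<^bsub>G\<^esub> free_lift G f v"
      using c True by (auto simp: Cons free_lift_def inv_letter_def)
    moreover have "free_lift G f [x] \<otimes>\<^bsub>G\<^esub> (free_lift G f [y] \<otimes>\<^bsub>G\<^esub> free_lift G f v) = free_lift G f v"
      using c True by (auto simp: free_lift_def inv_letter_def m_assoc[symmetric])
    ultimately show ?thesis using True Cons by simp
  next
    case False
    then show ?thesis using c Cons by (auto simp: free_lift_def)
  qed
qed

private lemma lift_foldr:
  assumes "snd ` set u \<subseteq> {1..n}" "snd ` set v \<subseteq> {1..n}"
  shows "free_lift G f (foldr push_letter u v) = free_lift G f u \<otimes>\<^bsub>G\<^esub> free_lift G f v"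
  using assms
proof (induction u)
  case Nil
  then show ?case using lift_closed by (auto simp: free_lift_def)
next
  case (Cons x u)
  have "snd ` set (x # foldr push_letter u v) \<subseteq> {1..n}"
    using Cons.prems image_mono[OF set_foldr_push[of u v], of snd]
    unfolding image_Un list.set image_insert by blast
  then have "free_lift G f (foldr push_letter (x # u) v) =
     free_lift G f [x] \<otimes>\<^bsub>G\<^esub> (free_lift G f u \<otimes>\<^bsub>G\<^esub> free_lift G f v)"
    using lift_push Cons by auto
  also have "\<dots> = free_lift G f (x # u) \<otimes>\<^bsub>G\<^esub> free_lift G f v"
  proof -
    have "f (snd x) \<in> carrier G" "free_lift G f u \<in> carrier G" "free_lift G f v \<in> carrier G"
      using Cons.prems f lift_closed by auto
    then show ?thesis unfolding free_lift_def by (auto simp: m_assoc)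
  qed
  finally show ?case .
qed

lemma free_lift_hom: "free_lift G f \<in> hom (free_group n) G"
  using lift_closed lift_foldr by (auto simp: hom_def free_group_def)

lemma free_lift_gen: "1 \<le> i \<Longrightarrow> i \<le> n \<Longrightarrow> free_lift G f (free_gen i) = f i"
  using f by (auto simp: free_lift_def free_gen_def)

lemma free_lift_unique:
  assumes h: "h \<in> hom (free_group n) G" and hf: "\<And>i. 1 \<le> i \<Longrightarrow> i \<le> n \<Longrightarrow> h (free_gen i) = f i"
    and w: "w \<in> carrier (free_group n)"
  shows "h w = free_lift G f w"
proof -
  interpret F: group "free_group n" by (rule group_free_group)
  interpret H: group_hom "free_group n" G h
    using h G group_free_group by (simp add: group_hom_def group_hom_axioms_def)
  show ?thesis using w
  proof (induction w)
    case Nil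
    then show ?case using H.hom_one by (simp add: free_lift_def free_group_def)
  next
    case (Cons x w)
    obtain b i where x: "x = (b, i)" by fastforce
    have i: "1 \<le> i" "i \<le> n" and w: "w \<in> carrier (free_group n)"
      and xw: "[x] \<in> carrier (free_group n)"
      using Cons.prems x reduced_ConsD by (auto simp: free_group_def reduced_def)
    have "x # w = [x] \<otimes>\<^bsub>free_group n\<^esub> w"
      using Cons.prems push_letter_reduced by (auto simp: free_group_def)
    then have 1: "h (x # w) = h [x] \<otimes>\<^bsub>G\<^esub> free_lift G f w"
      using Cons.IH w xw by simp
    have "h [x] = (if b then f i else inv\<^bsub>G\<^esub> (f i))"
    proof (cases b)
      case True
      then show ?thesis using hf[of i] i by (simp add: x free_gen_def)
    next
      case False
      have "[x] \<otimes>\<^bsub>free_group n\<^esub> free_gen i = \<one>\<^bsub>free_group n\<^esub>"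
        using False by (simp add: x free_gen_def free_group_def inv_letter_def)
      then have "[x] = inv\<^bsub>free_group n\<^esub> (free_gen i)"
        using F.inv_equality i free_gen_closed xw by metis
      then show ?thesis using False hf i free_gen_closed by simp
    qed
    then show ?case using 1 by (simp add: free_lift_def x)
  qed
qed

end

definition phi_hom :: "nat \<Rightarrow> nat \<Rightarrow> letter list \<Rightarrow> letter list \<times> letter list" where
  "phi_hom n m = free_lift (free_group n \<times>\<times> free_group m)
     (\<lambda>k. (free_gen ((k - 1) div m + 1), free_gen ((k - 1) mod m + 1)))"

lemma phi_hom_hom: "phi_hom n m \<in> hom (free_group (n * m)) (free_group n \<times>\<times> free_group m)"
  unfolding phi_hom_def
proof (rule free_lift_hom)
  fix k assume k: "1 \<le> k" "k \<le> n * m"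
  then have "m > 0" by (cases m) auto
  then show "(free_gen ((k - 1) div m + 1), free_gen ((k - 1) mod m + 1))
      \<in> carrier (free_group n \<times>\<times> free_group m)"
    using k by (auto intro!: free_gen_closed simp: Suc_le_eq less_mult_imp_div_less)
qed (simp add: DirProd_group group_free_group)

lemma phi_hom_gen:
  assumes "1 \<le> i" "i \<le> n" "1 \<le> j" "j \<le> m"
  shows "phi_hom n m (free_gen (m * (i - 1) + j)) = (free_gen i, free_gen j)"
proof -
  have "m * (i - 1) + j \<le> m * (i - 1) + m" using assms by simp
  also have "\<dots> = m * i" using assms by (cases i) auto
  also have "\<dots> \<le> n * m" using assms by simp
  finally have le: "m * (i - 1) + j \<le> n * m" .
  have "(m * (i - 1) + j - 1) div m = i - 1" "(m * (i - 1) + j - 1) mod m = j - 1"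
  proof -
    have e: "m * (i - 1) + j - 1 = (j - 1) + m * (i - 1)" using assms by simp
    have "j - 1 < m" using assms by simp
    then show "(m * (i - 1) + j - 1) div m = i - 1" "(m * (i - 1) + j - 1) mod m = j - 1"
      unfolding e using assms by (simp_all only: div_mult_self2 mod_mult_self2 div_less mod_less)
  qed
  note dm = this
  have "phi_hom n m (free_gen (m * (i - 1) + j)) =
     (free_gen ((m * (i - 1) + j - 1) div m + 1), free_gen ((m * (i - 1) + j - 1) mod m + 1))"
    unfolding phi_hom_def
  proof (rule free_lift_gen)
    fix k assume k: "1 \<le> k" "k \<le> n * m"
    then have "m > 0" by (cases m) auto
    then show "(free_gen ((k - 1) div m + 1), free_gen ((k - 1) mod m + 1))
        \<in> carrier (free_group n \<times>\<times> free_group m)"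
      using k by (auto intro!: free_gen_closed simp: Suc_le_eq less_mult_imp_div_less)
  qed (use assms le in \<open>auto simp: DirProd_group group_free_group\<close>)
  then show ?thesis using dm assms by simp
qed

section \<open>Complex Hilbert spaces\<close>

text \<open>A complex inner product space is a module over the field of complex numbers (the fields
  \<open>mult\<close> and \<open>one\<close>, inherited from rings, are not used) with an inner product that is linear in the
  first argument.\<close>

record 'a inner_space = "(complex, 'a) module" +
  cinner :: "'a \<Rightarrow> 'a \<Rightarrow> complex"

definition complex_field :: "complex ring" where
  "complex_field = \<lparr>carrier = UNIV, monoid.mult = (*), one = 1, ring.zero = 0, add = (+)\<rparr>"

definition cnorm :: "('a, 'm) inner_space_scheme \<Rightarrow> 'a \<Rightarrow> real" where
  "cnorm H x = sqrt (Re (cinner H x x))"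

text \<open>The value off the carrier only serves the conventions of \<open>Metric_space\<close>, which wants
  distances to be symmetric and nonnegative everywhere.\<close>

definition cdist :: "('a, 'm) inner_space_scheme \<Rightarrow> 'a \<Rightarrow> 'a \<Rightarrow> real" where
  "cdist H x y = (if x \<in> carrier H \<and> y \<in> carrier H then cnorm H (x \<ominus>\<^bsub>H\<^esub> y) else 0)"

locale semi_inner_space = module complex_field H for H :: "('a, 'm) inner_space_scheme" (structure) +
  assumes cinner_add_left: "\<lbrakk>x \<in> carrier H; y \<in> carrier H; z \<in> carrier H\<rbrakk>
      \<Longrightarrow> cinner H (x \<oplus> y) z = cinner H x z + cinner H y z"
    and cinner_scale_left: "\<lbrakk>x \<in> carrier H; y \<in> carrier H\<rbrakk>
      \<Longrightarrow> cinner H (c \<odot> x) y = c * cinner H x y"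
    and cinner_commute: "\<lbrakk>x \<in> carrier H; y \<in> carrier H\<rbrakk> \<Longrightarrow> cinner H x y = cnj (cinner H y x)"
    and cinner_nonneg: "x \<in> carrier H \<Longrightarrow> 0 \<le> Re (cinner H x x)"

locale inner_product_space = semi_inner_space +
  assumes cinner_definite: "\<lbrakk>x \<in> carrier H; cinner H x x = 0\<rbrakk> \<Longrightarrow> x = \<zero>"

locale hilbert_space = inner_product_space +
  assumes complete: "Metric_space.mcomplete (carrier H) (cdist H)"

lemma complex_field_simps [simp]:
  "carrier complex_field = UNIV" "\<one>\<^bsub>complex_field\<^esub> = 1" "\<zero>\<^bsub>complex_field\<^esub> = 0"
  "a \<oplus>\<^bsub>complex_field\<^esub> b = a + b" "a \<otimes>\<^bsub>complex_field\<^esub> b = a * b"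
  by (simp_all add: complex_field_def)

lemma cring_complex_field: "cring complex_field"
proof (rule cringI)
  show "abelian_group complex_field"
  proof (rule abelian_groupI)
    fix x assume "x \<in> carrier complex_field"
    show "\<exists>y\<in>carrier complex_field. y \<oplus>\<^bsub>complex_field\<^esub> x = \<zero>\<^bsub>complex_field\<^esub>"
      by (rule bexI[of _ "- x"]) (simp_all add: complex_field_def)
  qed (simp_all add: complex_field_def)
  show "Group.comm_monoid complex_field"
    by (rule comm_monoidI) (simp_all add: complex_field_def)
qed (simp add: complex_field_def algebra_simps)

context semi_inner_space
begin

lemma a_inv_eq_smult: "x \<in> carrier H \<Longrightarrow> \<ominus> x = (-1) \<odot> x"
proof -
  assume x: "x \<in> carrier H"
  have "(-1) \<odot> x \<oplus> x = ((-1) + 1) \<odot> x"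
    using smult_l_distr[of "-1" 1 x] smult_one[of x] x by simp
  also have "\<dots> = \<zero>" using smult_l_null[of x] x by simp
  finally show ?thesis using x by (simp add: M.minus_equality)
qed

lemma minus_eq_smult: "\<lbrakk>x \<in> carrier H; y \<in> carrier H\<rbrakk> \<Longrightarrow> x \<ominus> y = x \<oplus> (-1) \<odot> y"
  by (simp add: a_inv_eq_smult M.minus_eq)

lemma smult_in [simp]: "x \<in> carrier H \<Longrightarrow> c \<odot> x \<in> carrier H"
  by (rule smult_closed) simp_all

lemma cinner_add_right: "\<lbrakk>x \<in> carrier H; y \<in> carrier H; z \<in> carrier H\<rbrakk>
    \<Longrightarrow> cinner H z (x \<oplus> y) = cinner H z x + cinner H z y"
  by (metis M.add.m_closed cinner_add_left cinner_commute complex_cnj_add)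

lemma cinner_scale_right: "\<lbrakk>x \<in> carrier H; y \<in> carrier H\<rbrakk>
    \<Longrightarrow> cinner H y (c \<odot> x) = cnj c * cinner H y x"
  by (metis smult_in cinner_scale_left cinner_commute complex_cnj_mult)

lemma cinner_diff_left: "\<lbrakk>x \<in> carrier H; y \<in> carrier H; z \<in> carrier H\<rbrakk>
    \<Longrightarrow> cinner H (x \<ominus> y) z = cinner H x z - cinner H y z"
  by (simp add: minus_eq_smult cinner_add_left cinner_scale_left)

lemma cinner_diff_right: "\<lbrakk>x \<in> carrier H; y \<in> carrier H; z \<in> carrier H\<rbrakk>
    \<Longrightarrow> cinner H z (x \<ominus> y) = cinner H z x - cinner H z y"
  by (simp add: minus_eq_smult cinner_add_right cinner_scale_right)

lemmas cinner_simps = cinner_add_left cinner_add_right cinner_scale_left cinner_scale_right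
  cinner_diff_left cinner_diff_right

lemma cinner_self_real: "x \<in> carrier H \<Longrightarrow> cinner H x x = of_real (Re (cinner H x x))"
  using cinner_commute[of x x] by (simp add: complex_eq_iff)

lemma cnorm_nonneg [simp]: "x \<in> carrier H \<Longrightarrow> 0 \<le> cnorm H x"
  by (simp add: cnorm_def cinner_nonneg)

lemma cnorm_sq: "x \<in> carrier H \<Longrightarrow> (cnorm H x)\<^sup>2 = Re (cinner H x x)"
  by (simp add: cnorm_def cinner_nonneg)

lemma cauchy_schwarz:
  assumes x: "x \<in> carrier H" and y: "y \<in> carrier H"
  shows "cmod (cinner H x y) \<le> cnorm H x * cnorm H y"
proof -
  define c where "c = cinner H x y"
  define a where "a = Re (cinner H x x)"
  define b where "b = Re (cinner H y y)"
  have b0: "b \<ge> 0" and a0: "a \<ge> 0" using x y cinner_nonneg by (auto simp: a_def b_def)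
  have key: "0 \<le> a - 2 * s * (cmod c)\<^sup>2 + s\<^sup>2 * (cmod c)\<^sup>2 * b" for s :: real
  proof -
    define t where "t = - (of_real s * c)"
    have yx: "cinner H y x = cnj c" using cinner_commute[OF y x] by (simp add: c_def)
    have yy: "cinner H y y = of_real b" using cinner_self_real[OF y] by (simp add: b_def)
    have "0 \<le> Re (cinner H (x \<oplus> t \<odot> y) (x \<oplus> t \<odot> y))"
      using x y by (intro cinner_nonneg) simp
    also have "cinner H (x \<oplus> t \<odot> y) (x \<oplus> t \<odot> y) =
        cinner H x x + cnj t * c + t * cnj c + t * cnj t * of_real b"
      using x y yx yy by (simp add: cinner_simps c_def algebra_simps)
    also have "Re \<dots> = a - 2 * s * (cmod c)\<^sup>2 + s\<^sup>2 * (cmod c)\<^sup>2 * b"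
      unfolding t_def cmod_power2 by (simp add: a_def power2_eq_square algebra_simps)
    finally show ?thesis .
  qed
  have "(cmod c)\<^sup>2 \<le> a * b"
  proof (cases "b = 0")
    case True
    have "c = 0"
    proof (rule ccontr)
      assume "c \<noteq> 0"
      then show False
        using key[of "(a + 1) / (2 * (cmod c)\<^sup>2)"] True a0 by (simp add: field_simps)
    qed
    then show ?thesis using True by simp
  next
    case False
    then show ?thesis using key[of "1 / b"] b0 by (simp add: field_simps power2_eq_square)
  qed
  then have "(cmod c)\<^sup>2 \<le> (cnorm H x * cnorm H y)\<^sup>2"
    using x y by (simp add: power_mult_distrib cnorm_sq a_def b_def)
  then show ?thesis unfolding c_def
    by (rule power2_le_imp_le) (use x y in simp)
qed

lemma cnorm_triangle:
  assumes x: "x \<in> carrier H" and y: "y \<in> carrier H"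
  shows "cnorm H (x \<oplus> y) \<le> cnorm H x + cnorm H y"
proof (rule power2_le_imp_le)
  have "Re (cinner H x y) \<le> cnorm H x * cnorm H y"
    using cauchy_schwarz[OF x y] complex_Re_le_cmod order_trans by blast
  moreover have "Re (cinner H y x) = Re (cinner H x y)"
    using cinner_commute[OF y x] by simp
  ultimately show "(cnorm H (x \<oplus> y))\<^sup>2 \<le> (cnorm H x + cnorm H y)\<^sup>2"
    using x y by (simp add: cnorm_sq cinner_simps power2_sum)
qed (use x y in simp)

lemma cnorm_smult: "x \<in> carrier H \<Longrightarrow> cnorm H (c \<odot> x) = cmod c * cnorm H x"
proof (rule power2_eq_imp_eq)
  assume x: "x \<in> carrier H"
  have "cinner H (c \<odot> x) (c \<odot> x) = of_real ((cmod c)\<^sup>2 * Re (cinner H x x))"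
    using cinner_self_real[OF x] x complex_norm_square[of c]
    by (simp add: cinner_simps algebra_simps)
  then show "(cnorm H (c \<odot> x))\<^sup>2 = (cmod c * cnorm H x)\<^sup>2"
    using x by (simp add: cnorm_sq power_mult_distrib)
qed simp_all

lemma cnorm_zero [simp]: "cnorm H \<zero> = 0"
  using cnorm_smult[of \<zero> 0] smult_l_null[of \<zero>] by simp

lemma cdist_eq: "\<lbrakk>x \<in> carrier H; y \<in> carrier H\<rbrakk> \<Longrightarrow> cdist H x y = cnorm H (x \<ominus> y)"
  by (simp add: cdist_def)

lemma cdist_nonneg [simp]: "0 \<le> cdist H x y"
  by (simp add: cdist_def)

lemma minus_minus_smult: "\<lbrakk>x \<in> carrier H; y \<in> carrier H\<rbrakk> \<Longrightarrow> y \<ominus> x = (-1) \<odot> (x \<ominus> y)"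
  by (simp add: a_inv_eq_smult[symmetric] M.minus_eq M.minus_add M.a_comm)

lemma cdist_commute: "cdist H x y = cdist H y x"
  using minus_minus_smult[of x y] by (auto simp: cdist_def cnorm_smult)

lemma cdist_triangle:
  assumes "x \<in> carrier H" "y \<in> carrier H" "z \<in> carrier H"
  shows "cdist H x z \<le> cdist H x y + cdist H y z"
proof -
  have "x \<ominus> z = (x \<ominus> y) \<oplus> (y \<ominus> z)"
    using assms by (simp add: M.minus_eq M.a_assoc M.r_neg1)
  then show ?thesis using assms cnorm_triangle[of "x \<ominus> y" "y \<ominus> z"] by (simp add: cdist_eq)
qed

lemma cdist_self [simp]: "cdist H x x = 0"
  by (simp add: cdist_def M.minus_eq M.r_neg)

lemma cdist_add:
  assumes "x \<in> carrier H" "y \<in> carrier H" "x' \<in> carrier H" "y' \<in> carrier H"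
  shows "cdist H (x \<oplus> y) (x' \<oplus> y') \<le> cdist H x x' + cdist H y y'"
proof -
  have "(x \<oplus> y) \<ominus> (x' \<oplus> y') = (x \<ominus> x') \<oplus> (y \<ominus> y')"
    using assms by (simp add: M.minus_eq M.minus_add M.add.m_ac)
  then show ?thesis using assms cnorm_triangle[of "x \<ominus> x'" "y \<ominus> y'"] by (simp add: cdist_eq)
qed

lemma cdist_smult:
  assumes "x \<in> carrier H" "y \<in> carrier H"
  shows "cdist H (c \<odot> x) (c \<odot> y) = cmod c * cdist H x y"
proof -
  have "c \<odot> x \<ominus> c \<odot> y = c \<odot> (x \<ominus> y)"
    using assms smult_assoc1[of c "-1" y] smult_assoc1[of "-1" c y]
    by (simp add: minus_eq_smult smult_r_distr)
  then show ?thesis using assms by (simp add: cdist_eq cnorm_smult)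
qed

lemma cnorm_diff_le:
  assumes "x \<in> carrier H" "y \<in> carrier H"
  shows "cnorm H x \<le> cnorm H y + cdist H x y"
proof -
  have "x = (x \<ominus> y) \<oplus> y" using assms by (simp add: M.minus_eq M.a_assoc M.l_neg)
  then show ?thesis using assms cnorm_triangle[of "x \<ominus> y" y] by (simp add: cdist_eq)
qed

lemma cinner_diff_bound:
  assumes "x \<in> carrier H" "y \<in> carrier H" "x' \<in> carrier H" "y' \<in> carrier H"
  shows "cmod (cinner H x y - cinner H x' y')
    \<le> cdist H x x' * cnorm H y + cnorm H x' * cdist H y y'"
proof -
  have "cinner H x y - cinner H x' y' = cinner H (x \<ominus> x') y + cinner H x' (y \<ominus> y')"
    using assms by (simp add: cinner_simps)
  also have "cmod \<dots> \<le> cmod (cinner H (x \<ominus> x') y) + cmod (cinner H x' (y \<ominus> y'))"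
    by (rule norm_triangle_ineq)
  also have "\<dots> \<le> cdist H x x' * cnorm H y + cnorm H x' * cdist H y y'"
    using assms cauchy_schwarz[of "x \<ominus> x'" y] cauchy_schwarz[of x' "y \<ominus> y'"]
    by (simp add: cdist_eq)
  finally show ?thesis .
qed

end

lemma (in inner_product_space) cdist_Metric_space: "Metric_space (carrier H) (cdist H)"
proof
  fix x y assume xy: "x \<in> carrier H" "y \<in> carrier H"
  show "cdist H x y = 0 \<longleftrightarrow> x = y"
  proof
    assume "cdist H x y = 0"
    then have "Re (cinner H (x \<ominus> y) (x \<ominus> y)) = 0"
      using xy by (simp add: cdist_eq cnorm_def)
    then have "x \<ominus> y = \<zero>"
      using xy cinner_definite[of "x \<ominus> y"] cinner_self_real[of "x \<ominus> y"] by simp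
    then have "(x \<ominus> y) \<oplus> y = y" using xy by simp
    then show "x = y" using xy by (simp add: M.minus_eq M.a_assoc M.l_neg)
  qed simp
qed (use cdist_commute cdist_triangle in auto)

definition linear_isometry ::
  "('a, 'm) inner_space_scheme \<Rightarrow> ('b, 'n) inner_space_scheme \<Rightarrow> ('a \<Rightarrow> 'b) \<Rightarrow> bool" where
  "linear_isometry H K U \<longleftrightarrow>
     U \<in> carrier H \<rightarrow> carrier K \<and>
     (\<forall>x\<in>carrier H. \<forall>y\<in>carrier H. U (x \<oplus>\<^bsub>H\<^esub> y) = U x \<oplus>\<^bsub>K\<^esub> U y) \<and>
     (\<forall>c. \<forall>x\<in>carrier H. U (c \<odot>\<^bsub>H\<^esub> x) = c \<odot>\<^bsub>K\<^esub> U x) \<and>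
     (\<forall>x\<in>carrier H. \<forall>y\<in>carrier H. cinner K (U x) (U y) = cinner H x y)"

section \<open>Completion\<close>

text \<open>The Hausdorff completion of a semi-inner product space: Cauchy sequences modulo sequences
  of seminorm tending to zero. Vectors of seminorm zero are thereby identified with zero.\<close>

definition cauchy_seqs :: "('v, 'm) inner_space_scheme \<Rightarrow> (nat \<Rightarrow> 'v) set" where
  "cauchy_seqs V = {s. (\<forall>n. s n \<in> carrier V) \<and>
     (\<forall>e>0. \<exists>N. \<forall>m\<ge>N. \<forall>n\<ge>N. cdist V (s m) (s n) < e)}"

definition null_rel :: "('v, 'm) inner_space_scheme \<Rightarrow> ((nat \<Rightarrow> 'v) \<times> (nat \<Rightarrow> 'v)) set" where
  "null_rel V = {(s, t). s \<in> cauchy_seqs V \<and> t \<in> cauchy_seqs V \<and>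
     (\<lambda>n. cdist V (s n) (t n)) \<longlonglongrightarrow> 0}"

definition completion :: "('v, 'm) inner_space_scheme \<Rightarrow> (nat \<Rightarrow> 'v) set inner_space" where
  "completion V = \<lparr>carrier = cauchy_seqs V // null_rel V,
     monoid.mult = undefined, one = undefined,
     ring.zero = null_rel V `` {\<lambda>n. \<zero>\<^bsub>V\<^esub>},
     add = (\<lambda>S T. \<Union>s\<in>S. \<Union>t\<in>T. null_rel V `` {\<lambda>n. s n \<oplus>\<^bsub>V\<^esub> t n}),
     smult = (\<lambda>c S. \<Union>s\<in>S. null_rel V `` {\<lambda>n. c \<odot>\<^bsub>V\<^esub> s n}),
     cinner = (\<lambda>S T. THE c. \<exists>s\<in>S. \<exists>t\<in>T. (\<lambda>n. cinner V (s n) (t n)) \<longlonglongrightarrow> c)\<rparr>"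

definition completion_map ::
  "('v, 'm) inner_space_scheme \<Rightarrow> ('w, 'n) inner_space_scheme \<Rightarrow> ('v \<Rightarrow> 'w) \<Rightarrow>
    (nat \<Rightarrow> 'v) set \<Rightarrow> (nat \<Rightarrow> 'w) set" where
  "completion_map V W f = (\<lambda>S\<in>carrier (completion V). \<Union>s\<in>S. null_rel W `` {\<lambda>n. f (s n)})"

lemma null_sequence_squeeze:
  fixes f g :: "nat \<Rightarrow> real"
  assumes "g \<longlonglongrightarrow> 0" "\<And>n. 0 \<le> f n" "\<And>n. f n \<le> g n"
  shows "f \<longlonglongrightarrow> 0"
  using assms by (intro tendsto_sandwich[of "\<lambda>n. 0" f sequentially g 0]) simp_all

context semi_inner_space
begin

abbreviation (input) "CS \<equiv> cauchy_seqs H"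
abbreviation (input) "cls s \<equiv> null_rel H `` {s}"
abbreviation (input) "CH \<equiv> completion H"

lemma csD: "s \<in> CS \<Longrightarrow> s n \<in> carrier H"
  by (simp add: cauchy_seqs_def)

lemma csE:
  assumes "s \<in> CS" "e > 0"
  obtains N where "\<And>m n. m \<ge> N \<Longrightarrow> n \<ge> N \<Longrightarrow> cdist H (s m) (s n) < e"
proof -
  have "\<exists>N. \<forall>m\<ge>N. \<forall>n\<ge>N. cdist H (s m) (s n) < e"
    using assms by (simp add: cauchy_seqs_def)
  then show thesis using that by blast
qed

lemma cs_const [simp]: "x \<in> carrier H \<Longrightarrow> (\<lambda>n. x) \<in> CS"
  by (simp add: cauchy_seqs_def)

lemma cs_add:
  assumes s: "s \<in> CS" and t: "t \<in> CS"
  shows "(\<lambda>n. s n \<oplus> t n) \<in> CS"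
  unfolding cauchy_seqs_def
proof (intro CollectI conjI allI impI)
  fix e :: real assume "e > 0"
  then have e2: "e / 2 > 0" by simp
  obtain N where N: "\<And>m n. m \<ge> N \<Longrightarrow> n \<ge> N \<Longrightarrow> cdist H (s m) (s n) < e / 2"
    using csE[OF s e2] by blast
  obtain M where M: "\<And>m n. m \<ge> M \<Longrightarrow> n \<ge> M \<Longrightarrow> cdist H (t m) (t n) < e / 2"
    using csE[OF t e2] by blast
  show "\<exists>N. \<forall>m\<ge>N. \<forall>n\<ge>N. cdist H (s m \<oplus> t m) (s n \<oplus> t n) < e"
  proof (intro exI allI impI)
    fix m n assume "m \<ge> max N M" "n \<ge> max N M"
    then show "cdist H (s m \<oplus> t m) (s n \<oplus> t n) < e"
      using N[of m n] M[of m n] cdist_add[of "s m" "t m" "s n" "t n"] csD s t by fastforce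
  qed
qed (use s t csD in simp)

lemma cs_smult:
  assumes s: "s \<in> CS"
  shows "(\<lambda>n. c \<odot> s n) \<in> CS"
  unfolding cauchy_seqs_def
proof (intro CollectI conjI allI impI)
  fix e :: real assume "e > 0"
  then have e2: "e / (cmod c + 1) > 0" by (simp add: add_nonneg_pos)
  obtain N where N: "\<And>m n. m \<ge> N \<Longrightarrow> n \<ge> N \<Longrightarrow> cdist H (s m) (s n) < e / (cmod c + 1)"
    using csE[OF s e2] by blast
  show "\<exists>N. \<forall>m\<ge>N. \<forall>n\<ge>N. cdist H (c \<odot> s m) (c \<odot> s n) < e"
  proof (intro exI allI impI)
    fix m n assume mn: "m \<ge> N" "n \<ge> N"
    have p: "cmod c + 1 > 0" by (simp add: add_nonneg_pos)
    have "cmod c * cdist H (s m) (s n) \<le> (cmod c + 1) * cdist H (s m) (s n)"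
      by (intro mult_right_mono) simp_all
    also have "\<dots> < e" using N[OF mn] p by (simp add: pos_less_divide_eq mult.commute)
    finally show "cdist H (c \<odot> s m) (c \<odot> s n) < e"
      using s by (simp add: cdist_smult csD)
  qed
qed (use s csD in simp)

lemma null_rel_iff: "(s, t) \<in> null_rel H \<longleftrightarrow>
    s \<in> CS \<and> t \<in> CS \<and> (\<lambda>n. cdist H (s n) (t n)) \<longlonglongrightarrow> 0"
  by (simp add: null_rel_def)

lemma equiv_null_rel: "equiv CS (null_rel H)"
proof (rule equivI)
  show "refl_on CS (null_rel H)"
    by (rule refl_onI) (auto simp: null_rel_def)
  show "sym (null_rel H)"
    by (rule symI) (auto simp: null_rel_def cdist_commute)
  show "trans (null_rel H)"
  proof (rule transI)
    fix r s t assume a: "(r, s) \<in> null_rel H" "(s, t) \<in> null_rel H"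
    have "(\<lambda>n. cdist H (r n) (s n) + cdist H (s n) (t n)) \<longlonglongrightarrow> 0"
      using a by (intro tendsto_add_zero) (simp_all add: null_rel_iff)
    then have "(\<lambda>n. cdist H (r n) (t n)) \<longlonglongrightarrow> 0"
      by (rule null_sequence_squeeze) (use a in \<open>simp_all add: null_rel_iff cdist_triangle csD\<close>)
    then show "(r, t) \<in> null_rel H" using a by (simp add: null_rel_iff)
  qed
qed (auto simp: null_rel_def)

lemma cls_eq_iff: "\<lbrakk>s \<in> CS; t \<in> CS\<rbrakk> \<Longrightarrow>
    cls s = cls t \<longleftrightarrow> (\<lambda>n. cdist H (s n) (t n)) \<longlonglongrightarrow> 0"
  using eq_equiv_class_iff[OF equiv_null_rel] by (simp add: null_rel_iff)

lemma cls_in [simp]: "s \<in> CS \<Longrightarrow> cls s \<in> carrier CH"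
  by (simp add: completion_def quotientI)

lemma CH_cases:
  assumes "S \<in> carrier CH"
  obtains s where "s \<in> CS" "S = cls s"
  using assms by (auto simp: completion_def elim: quotientE)

lemma zero_CH: "\<zero>\<^bsub>CH\<^esub> = cls (\<lambda>n. \<zero>)"
  by (simp add: completion_def)

lemma add_cls:
  assumes "s \<in> CS" "t \<in> CS"
  shows "cls s \<oplus>\<^bsub>CH\<^esub> cls t = cls (\<lambda>n. s n \<oplus> t n)"
proof -
  have "(\<lambda>s t. cls (\<lambda>n. s n \<oplus> t n)) respects2 null_rel H"
  proof (rule congruent2I')
    fix s s' t t' assume a: "(s, s') \<in> null_rel H" "(t, t') \<in> null_rel H"
    have "(\<lambda>n. cdist H (s n) (s' n) + cdist H (t n) (t' n)) \<longlonglongrightarrow> 0"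
      using a by (intro tendsto_add_zero) (simp_all add: null_rel_iff)
    then have "(\<lambda>n. cdist H (s n \<oplus> t n) (s' n \<oplus> t' n)) \<longlonglongrightarrow> 0"
      by (rule null_sequence_squeeze) (use a in \<open>simp_all add: null_rel_iff cdist_add csD\<close>)
    then show "cls (\<lambda>n. s n \<oplus> t n) = cls (\<lambda>n. s' n \<oplus> t' n)"
      using a by (simp add: cls_eq_iff cs_add null_rel_iff)
  qed
  then show ?thesis
    using UN_equiv_class2[OF equiv_null_rel equiv_null_rel _ assms] by (simp add: completion_def)
qed

lemma smult_cls:
  assumes "s \<in> CS"
  shows "c \<odot>\<^bsub>CH\<^esub> cls s = cls (\<lambda>n. c \<odot> s n)"
proof -
  have "(\<lambda>s. cls (\<lambda>n. c \<odot> s n)) respects null_rel H"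
  proof (rule congruentI)
    fix s s' assume a: "(s, s') \<in> null_rel H"
    then have "(\<lambda>n. cmod c * cdist H (s n) (s' n)) \<longlonglongrightarrow> cmod c * 0"
      by (intro tendsto_mult_left) (auto simp: null_rel_iff)
    then have "(\<lambda>n. cdist H (c \<odot> s n) (c \<odot> s' n)) \<longlonglongrightarrow> 0"
      using a by (simp add: null_rel_iff cdist_smult csD)
    then show "cls (\<lambda>n. c \<odot> s n) = cls (\<lambda>n. c \<odot> s' n)"
      using a by (simp add: cls_eq_iff cs_smult null_rel_iff)
  qed
  then show ?thesis
    using UN_equiv_class[OF equiv_null_rel _ assms] by (simp add: completion_def)
qed

lemma cs_bounded:
  assumes s: "s \<in> CS"
  obtains B where "B > 0" "\<And>n. cnorm H (s n) \<le> B"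
proof -
  obtain N where N: "\<And>m n. m \<ge> N \<Longrightarrow> n \<ge> N \<Longrightarrow> cdist H (s m) (s n) < 1"
    using csE[OF s zero_less_one] by blast
  define B where "B = (\<Sum>n\<le>N. cnorm H (s n)) + 1"
  have le: "cnorm H (s n) \<le> (\<Sum>n\<le>N. cnorm H (s n))" if "n \<le> N" for n
    using that csD[OF s] by (intro member_le_sum) auto
  have "cnorm H (s n) \<le> B" for n
  proof (cases "n \<le> N")
    case True
    then show ?thesis using le by (simp add: B_def add_increasing2)
  next
    case False
    then show ?thesis
      using cnorm_diff_le[of "s n" "s N"] N[of n N] csD[OF s] le[of N] by (simp add: B_def)
  qed
  moreover have "B > 0"
    unfolding B_def using csD[OF s] by (intro add_nonneg_pos sum_nonneg) auto
  ultimately show ?thesis using that by blast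
qed

lemma cinner_seq_convergent:
  assumes s: "s \<in> CS" and t: "t \<in> CS"
  shows "convergent (\<lambda>n. cinner H (s n) (t n))"
proof (rule Cauchy_convergent, rule metric_CauchyI)
  fix e :: real assume e: "e > 0"
  obtain A where A: "A > 0" "\<And>n. cnorm H (s n) \<le> A" using cs_bounded[OF s] by blast
  obtain B where B: "B > 0" "\<And>n. cnorm H (t n) \<le> B" using cs_bounded[OF t] by blast
  obtain N where N: "\<And>m n. m \<ge> N \<Longrightarrow> n \<ge> N \<Longrightarrow> cdist H (s m) (s n) < e / (2 * B)"
    using csE[OF s, of "e / (2 * B)"] e B(1) by auto
  obtain M where M: "\<And>m n. m \<ge> M \<Longrightarrow> n \<ge> M \<Longrightarrow> cdist H (t m) (t n) < e / (2 * A)"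
    using csE[OF t, of "e / (2 * A)"] e A(1) by auto
  show "\<exists>N. \<forall>m\<ge>N. \<forall>n\<ge>N. dist (cinner H (s m) (t m)) (cinner H (s n) (t n)) < e"
  proof (intro exI allI impI)
    fix m n assume mn: "m \<ge> max N M" "n \<ge> max N M"
    have "cmod (cinner H (s m) (t m) - cinner H (s n) (t n))
        \<le> cdist H (s m) (s n) * cnorm H (t m) + cnorm H (s n) * cdist H (t m) (t n)"
      using s t by (intro cinner_diff_bound csD)
    also have "\<dots> \<le> cdist H (s m) (s n) * B + A * cdist H (t m) (t n)"
      using A B by (intro add_mono mult_left_mono mult_right_mono) auto
    also have "\<dots> < e / (2 * B) * B + A * (e / (2 * A))"
      using A(1) B(1) N[of m n] M[of m n] mn
      by (intro add_strict_mono mult_strict_right_mono mult_strict_left_mono) auto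
    also have "\<dots> = e" using A(1) B(1) by simp
    finally show "dist (cinner H (s m) (t m)) (cinner H (s n) (t n)) < e"
      by (simp add: dist_norm)
  qed
qed

lemma cinner_seq_diff:
  assumes a: "(s, s') \<in> null_rel H" and b: "(t, t') \<in> null_rel H"
  shows "(\<lambda>n. cinner H (s n) (t n) - cinner H (s' n) (t' n)) \<longlonglongrightarrow> 0"
proof -
  have st: "s \<in> CS" "s' \<in> CS" "t \<in> CS" "t' \<in> CS" using a b by (auto simp: null_rel_iff)
  obtain A where A: "A > 0" "\<And>n. cnorm H (s' n) \<le> A" using cs_bounded[OF st(2)] by blast
  obtain B where B: "B > 0" "\<And>n. cnorm H (t n) \<le> B" using cs_bounded[OF st(3)] by blast
  have le: "cmod (cinner H (s n) (t n) - cinner H (s' n) (t' n))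
      \<le> cdist H (s n) (s' n) * B + A * cdist H (t n) (t' n)" for n
  proof -
    have "cmod (cinner H (s n) (t n) - cinner H (s' n) (t' n))
        \<le> cdist H (s n) (s' n) * cnorm H (t n) + cnorm H (s' n) * cdist H (t n) (t' n)"
      using st by (intro cinner_diff_bound csD)
    also have "\<dots> \<le> cdist H (s n) (s' n) * B + A * cdist H (t n) (t' n)"
      using A B by (intro add_mono mult_left_mono mult_right_mono) auto
    finally show ?thesis .
  qed
  have "(\<lambda>n. cdist H (s n) (s' n) * B + A * cdist H (t n) (t' n)) \<longlonglongrightarrow> 0"
    using a b by (intro tendsto_add_zero tendsto_mult_left_zero tendsto_mult_right_zero)
      (simp_all add: null_rel_iff)
  then have "(\<lambda>n. cmod (cinner H (s n) (t n) - cinner H (s' n) (t' n))) \<longlonglongrightarrow> 0"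
    by (rule null_sequence_squeeze) (use le in simp_all)
  then show ?thesis by (rule tendsto_norm_zero_cancel)
qed

lemma cinner_cls:
  assumes s: "s \<in> CS" and t: "t \<in> CS"
  shows "(\<lambda>n. cinner H (s n) (t n)) \<longlonglongrightarrow> cinner CH (cls s) (cls t)"
proof -
  obtain c where c: "(\<lambda>n. cinner H (s n) (t n)) \<longlonglongrightarrow> c"
    using cinner_seq_convergent[OF s t] by (auto simp: convergent_def)
  have "cinner CH (cls s) (cls t) = c"
    unfolding completion_def inner_space.simps
  proof (rule the_equality)
    show "\<exists>s\<in>cls s. \<exists>t\<in>cls t. (\<lambda>n. cinner H (s n) (t n)) \<longlonglongrightarrow> c"
      using c equiv_class_self[OF equiv_null_rel] s t by blast
    fix d assume "\<exists>s\<in>cls s. \<exists>t\<in>cls t. (\<lambda>n. cinner H (s n) (t n)) \<longlonglongrightarrow> d"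
    then obtain s' t' where d: "(s, s') \<in> null_rel H" "(t, t') \<in> null_rel H"
      "(\<lambda>n. cinner H (s' n) (t' n)) \<longlonglongrightarrow> d" by auto
    have "(\<lambda>n. cinner H (s n) (t n) - cinner H (s' n) (t' n)) \<longlonglongrightarrow> c - d"
      by (intro tendsto_diff c d)
    then have "c - d = 0" using cinner_seq_diff[OF d(1,2)] LIMSEQ_unique by blast
    then show "d = c" by simp
  qed
  then show ?thesis using c by simp
qed

lemma cinner_clsI:
  "\<lbrakk>s \<in> CS; t \<in> CS; (\<lambda>n. cinner H (s n) (t n)) \<longlonglongrightarrow> c\<rbrakk> \<Longrightarrow> cinner CH (cls s) (cls t) = c"
  using cinner_cls LIMSEQ_unique by blast

lemma abelian_group_CH: "abelian_group CH"
proof (rule abelian_groupI)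
  fix S T assume "S \<in> carrier CH" "T \<in> carrier CH"
  then show "S \<oplus>\<^bsub>CH\<^esub> T \<in> carrier CH"
    by (elim CH_cases) (simp add: add_cls cs_add)
next
  show "\<zero>\<^bsub>CH\<^esub> \<in> carrier CH" by (simp add: zero_CH)
next
  fix R S T assume "R \<in> carrier CH" "S \<in> carrier CH" "T \<in> carrier CH"
  then show "R \<oplus>\<^bsub>CH\<^esub> S \<oplus>\<^bsub>CH\<^esub> T = R \<oplus>\<^bsub>CH\<^esub> (S \<oplus>\<^bsub>CH\<^esub> T)"
    by (elim CH_cases) (simp add: add_cls cs_add csD M.a_assoc)
next
  fix S T assume "S \<in> carrier CH" "T \<in> carrier CH"
  then show "S \<oplus>\<^bsub>CH\<^esub> T = T \<oplus>\<^bsub>CH\<^esub> S"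
    by (elim CH_cases) (simp add: add_cls csD M.a_comm)
next
  fix S assume "S \<in> carrier CH"
  then show "\<zero>\<^bsub>CH\<^esub> \<oplus>\<^bsub>CH\<^esub> S = S"
    by (elim CH_cases) (simp add: zero_CH add_cls csD)
next
  fix S assume "S \<in> carrier CH"
  then obtain s where s: "s \<in> CS" "S = cls s" by (elim CH_cases)
  have "(-1) \<odot> s n \<oplus> s n = \<zero>" for n
    using s by (simp add: a_inv_eq_smult[symmetric] csD M.l_neg)
  then show "\<exists>T\<in>carrier CH. T \<oplus>\<^bsub>CH\<^esub> S = \<zero>\<^bsub>CH\<^esub>"
    using s by (intro bexI[of _ "cls (\<lambda>n. (-1) \<odot> s n)"]) (simp_all add: zero_CH add_cls cs_smult)
qed

lemma module_CH: "module complex_field CH"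
proof (rule moduleI)
  fix a b S T assume "S \<in> carrier CH" "T \<in> carrier CH"
  then obtain s t where st: "s \<in> CS" "S = cls s" "t \<in> CS" "T = cls t" by (elim CH_cases)
  show "a \<odot>\<^bsub>CH\<^esub> S \<in> carrier CH" using st by (simp add: smult_cls cs_smult)
  show "a \<odot>\<^bsub>CH\<^esub> (S \<oplus>\<^bsub>CH\<^esub> T) = a \<odot>\<^bsub>CH\<^esub> S \<oplus>\<^bsub>CH\<^esub> a \<odot>\<^bsub>CH\<^esub> T"
    using st by (simp add: smult_cls add_cls cs_smult cs_add csD smult_r_distr)
next
  fix a b S assume "S \<in> carrier CH"
  then obtain s where s: "s \<in> CS" "S = cls s" by (elim CH_cases)
  have 1: "(a + b) \<odot> s n = a \<odot> s n \<oplus> b \<odot> s n" "(a * b) \<odot> s n = a \<odot> (b \<odot> s n)" for n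
    using smult_l_distr[of a b "s n"] smult_assoc1[of a b "s n"] csD[OF s(1)] by simp_all
  show "(a \<oplus>\<^bsub>complex_field\<^esub> b) \<odot>\<^bsub>CH\<^esub> S = a \<odot>\<^bsub>CH\<^esub> S \<oplus>\<^bsub>CH\<^esub> b \<odot>\<^bsub>CH\<^esub> S"
    using s by (simp add: smult_cls add_cls cs_smult 1)
  show "(a \<otimes>\<^bsub>complex_field\<^esub> b) \<odot>\<^bsub>CH\<^esub> S = a \<odot>\<^bsub>CH\<^esub> (b \<odot>\<^bsub>CH\<^esub> S)"
    using s by (simp add: smult_cls cs_smult 1)
  have "1 \<odot> s n = s n" for n using smult_one[of "s n"] csD[OF s(1)] by simp
  then show "\<one>\<^bsub>complex_field\<^esub> \<odot>\<^bsub>CH\<^esub> S = S"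
    using s by (simp add: smult_cls)
qed (simp_all add: cring_complex_field abelian_group_CH)

theorem inner_product_space_completion: "inner_product_space CH"
proof (intro inner_product_space.intro semi_inner_space.intro semi_inner_space_axioms.intro
    inner_product_space_axioms.intro module_CH)
  fix R S T assume "R \<in> carrier CH" "S \<in> carrier CH" "T \<in> carrier CH"
  then obtain r s t where *: "r \<in> CS" "R = cls r" "s \<in> CS" "S = cls s" "t \<in> CS" "T = cls t"
    by (elim CH_cases)
  have "(\<lambda>n. cinner H (r n) (t n) + cinner H (s n) (t n)) \<longlonglongrightarrow> cinner CH R T + cinner CH S T"
    using * by (auto intro!: tendsto_add cinner_cls)
  then show "cinner CH (R \<oplus>\<^bsub>CH\<^esub> S) T = cinner CH R T + cinner CH S T"
    using * by (simp add: add_cls) (rule cinner_clsI, simp_all add: cs_add csD cinner_add_left)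
next
  fix c S T assume "S \<in> carrier CH" "T \<in> carrier CH"
  then obtain s t where *: "s \<in> CS" "S = cls s" "t \<in> CS" "T = cls t" by (elim CH_cases)
  have "(\<lambda>n. c * cinner H (s n) (t n)) \<longlonglongrightarrow> c * cinner CH S T"
    using * by (auto intro!: tendsto_mult_left cinner_cls)
  then show "cinner CH (c \<odot>\<^bsub>CH\<^esub> S) T = c * cinner CH S T"
    using * by (simp add: smult_cls) (rule cinner_clsI, simp_all add: cs_smult csD cinner_scale_left)
next
  fix S T assume "S \<in> carrier CH" "T \<in> carrier CH"
  then obtain s t where *: "s \<in> CS" "S = cls s" "t \<in> CS" "T = cls t" by (elim CH_cases)
  have "(\<lambda>n. cnj (cinner H (t n) (s n))) \<longlonglongrightarrow> cnj (cinner CH T S)"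
    using * by (auto intro!: tendsto_cnj cinner_cls)
  moreover have "cinner H (s n) (t n) = cnj (cinner H (t n) (s n))" for n
    using * by (intro cinner_commute csD)
  ultimately show "cinner CH S T = cnj (cinner CH T S)"
    using * cinner_clsI by simp
next
  fix S assume "S \<in> carrier CH"
  then obtain s where *: "s \<in> CS" "S = cls s" by (elim CH_cases)
  have "(\<lambda>n. Re (cinner H (s n) (s n))) \<longlonglongrightarrow> Re (cinner CH S S)"
    using * by (auto intro!: tendsto_Re cinner_cls)
  then show "0 \<le> Re (cinner CH S S)"
    by (rule LIMSEQ_le_const) (use * csD cinner_nonneg in auto)
next
  fix S assume "S \<in> carrier CH" and 0: "cinner CH S S = 0"
  then obtain s where *: "s \<in> CS" "S = cls s" by (elim CH_cases)
  have "(\<lambda>n. sqrt (Re (cinner H (s n) (s n)))) \<longlonglongrightarrow> sqrt (Re 0)"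
    using cinner_cls[OF *(1) *(1)] 0 * by (intro tendsto_real_sqrt tendsto_Re) simp
  moreover have "cdist H (s n) \<zero> = sqrt (Re (cinner H (s n) (s n)))" for n
  proof -
    have "s n \<ominus> \<zero> = s n" using * csD by (simp add: M.minus_eq)
    then show ?thesis using * csD by (simp add: cdist_eq cnorm_def)
  qed
  ultimately show "S = \<zero>\<^bsub>CH\<^esub>"
    using * by (simp add: zero_CH cls_eq_iff)
qed

lemma cdist_cls:
  assumes s: "s \<in> CS" and t: "t \<in> CS"
  shows "(\<lambda>n. cdist H (s n) (t n)) \<longlonglongrightarrow> cdist CH (cls s) (cls t)"
proof -
  interpret C: inner_product_space CH by (rule inner_product_space_completion)
  define u where "u = (\<lambda>n. s n \<oplus> (-1) \<odot> t n)"
  have u: "u \<in> CS" unfolding u_def using s t by (intro cs_add cs_smult)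
  have d: "cls s \<ominus>\<^bsub>CH\<^esub> cls t = cls u"
    using s t by (simp add: C.minus_eq_smult smult_cls add_cls cs_smult u_def)
  have "(\<lambda>n. sqrt (Re (cinner H (u n) (u n)))) \<longlonglongrightarrow> sqrt (Re (cinner CH (cls u) (cls u)))"
    using u by (intro tendsto_real_sqrt tendsto_Re cinner_cls)
  moreover have "cdist H (s n) (t n) = sqrt (Re (cinner H (u n) (u n)))" for n
    using s t by (simp add: cdist_eq csD cnorm_def u_def minus_eq_smult)
  ultimately show ?thesis using s t d by (simp add: C.cdist_eq cnorm_def)
qed

theorem hilbert_space_completion: "hilbert_space CH"
proof (intro hilbert_space.intro hilbert_space_axioms.intro inner_product_space_completion)
  interpret C: inner_product_space CH by (rule inner_product_space_completion)
  interpret MS: Metric_space "carrier CH" "cdist CH" by (rule C.cdist_Metric_space)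
  show "MS.mcomplete"
    unfolding MS.mcomplete_def
  proof (intro allI impI)
    fix \<sigma> assume \<sigma>: "MS.MCauchy \<sigma>"
    then have \<sigma>C: "\<sigma> k \<in> carrier CH" for k by (auto simp: MS.MCauchy_def)
    have "\<exists>s. s \<in> CS \<and> \<sigma> k = cls s" for k using CH_cases[OF \<sigma>C] by metis
    then obtain s where s: "\<And>k. s k \<in> CS" "\<And>k. \<sigma> k = cls (s k)" by metis
    have "\<exists>N. \<forall>m\<ge>N. \<forall>n\<ge>N. cdist H (s k m) (s k n) < 1 / real (Suc k)" for k
      using s(1)[of k] by (simp add: cauchy_seqs_def del: of_nat_Suc)
    then obtain N where N: "\<And>k m n. \<lbrakk>m \<ge> N k; n \<ge> N k\<rbrakk> \<Longrightarrow> cdist H (s k m) (s k n) < 1 / real (Suc k)"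
      by metis
    define v where "v k = s k (N k)" for k
    have v: "v k \<in> carrier H" for k by (simp add: v_def csD s(1))
    define \<iota> where "\<iota> x = cls (\<lambda>n::nat. x)" for x
    have \<iota>C: "\<iota> (v k) \<in> carrier CH" for k by (simp add: \<iota>_def v)
    have \<iota>: "cdist CH (\<iota> (v k)) (\<iota> (v l)) = cdist H (v k) (v l)" for k l
      using cdist_cls[OF cs_const[OF v[of k]] cs_const[OF v[of l]]] LIMSEQ_unique tendsto_const
      unfolding \<iota>_def by blast
    have near: "cdist CH (\<iota> (v k)) (\<sigma> k) \<le> 1 / real (Suc k)" for k
    proof (rule LIMSEQ_le_const2)
      show "(\<lambda>n. cdist H (v k) (s k n)) \<longlonglongrightarrow> cdist CH (\<iota> (v k)) (\<sigma> k)"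
        unfolding \<iota>_def s(2) using s(1) v by (intro cdist_cls) simp_all
      show "\<exists>M. \<forall>n\<ge>M. cdist H (v k) (s k n) \<le> 1 / real (Suc k)"
        using N[of k "N k"] by (intro exI[of _ "N k"]) (auto simp: v_def intro: less_imp_le)
    qed
    have small: "\<exists>K. \<forall>k\<ge>K. 1 / real (Suc k) < e" if "e > 0" for e :: real
    proof -
      obtain K where K: "inverse (real (Suc K)) < e" using reals_Archimedean[OF \<open>e > 0\<close>] by blast
      have "1 / real (Suc k) < e" if "k \<ge> K" for k
      proof -
        have "1 / real (Suc k) \<le> 1 / real (Suc K)" using that by (intro divide_left_mono) auto
        then show ?thesis using K by (simp add: inverse_eq_divide)
      qed
      then show ?thesis by blast
    qed
    have vCS: "v \<in> CS"
      unfolding cauchy_seqs_def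
    proof (intro CollectI conjI allI impI v)
      fix e :: real assume e: "e > 0"
      obtain K where K: "\<And>k. k \<ge> K \<Longrightarrow> 1 / real (Suc k) < e / 3"
        using small[of "e / 3"] e by auto
      obtain L where L: "\<And>k l. \<lbrakk>k \<ge> L; l \<ge> L\<rbrakk> \<Longrightarrow> cdist CH (\<sigma> k) (\<sigma> l) < e / 3"
        using \<sigma> e unfolding MS.MCauchy_def by (meson divide_pos_pos zero_less_numeral)
      show "\<exists>N. \<forall>m\<ge>N. \<forall>n\<ge>N. cdist H (v m) (v n) < e"
      proof (intro exI allI impI)
        fix m n assume mn: "m \<ge> max K L" "n \<ge> max K L"
        have "cdist CH (\<iota> (v m)) (\<iota> (v n)) \<le> cdist CH (\<iota> (v m)) (\<sigma> m) + cdist CH (\<sigma> m) (\<iota> (v n))"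
          by (intro C.cdist_triangle \<iota>C \<sigma>C)
        also have "cdist CH (\<sigma> m) (\<iota> (v n)) \<le> cdist CH (\<sigma> m) (\<sigma> n) + cdist CH (\<sigma> n) (\<iota> (v n))"
          by (intro C.cdist_triangle \<iota>C \<sigma>C)
        finally show "cdist H (v m) (v n) < e"
          using near[of m] near[of n] K[of m] K[of n] L[of m n] mn C.cdist_commute[of "\<sigma> n" "\<iota> (v n)"]
          by (simp add: \<iota> del: of_nat_Suc)
      qed
    qed
    have "limitin MS.mtopology \<sigma> (cls v) sequentially"
      unfolding MS.limit_metric_sequentially
    proof (intro conjI allI impI)
      show "cls v \<in> carrier CH" using vCS by simp
      fix e :: real assume e: "e > 0"
      obtain K where K: "\<And>k. k \<ge> K \<Longrightarrow> 1 / real (Suc k) < e / 2"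
        using small[of "e / 2"] e by auto
      obtain L where L: "\<And>m n. m \<ge> L \<Longrightarrow> n \<ge> L \<Longrightarrow> cdist H (v m) (v n) < e / 2"
        using csE[OF vCS, of "e / 2"] e by auto
      have "cdist CH (\<sigma> k) (cls v) < e" if k: "k \<ge> max K L" for k
      proof -
        have "cdist CH (\<iota> (v k)) (cls v) \<le> e / 2"
        proof (rule LIMSEQ_le_const2)
          show "(\<lambda>n. cdist H (v k) (v n)) \<longlonglongrightarrow> cdist CH (\<iota> (v k)) (cls v)"
            unfolding \<iota>_def using vCS v by (intro cdist_cls) simp_all
          show "\<exists>M. \<forall>n\<ge>M. cdist H (v k) (v n) \<le> e / 2"
            using L[of k] k by (intro exI[of _ L]) (auto intro: less_imp_le)
        qed
        moreover have "cdist CH (\<sigma> k) (cls v) \<le> cdist CH (\<sigma> k) (\<iota> (v k)) + cdist CH (\<iota> (v k)) (cls v)"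
          using vCS by (intro C.cdist_triangle \<iota>C \<sigma>C cls_in)
        ultimately show ?thesis
          using near[of k] K[of k] k C.cdist_commute[of "\<sigma> k" "\<iota> (v k)"] by (simp del: of_nat_Suc)
      qed
      then show "\<exists>N. \<forall>n\<ge>N. \<sigma> n \<in> carrier CH \<and> cdist CH (\<sigma> n) (cls v) < e"
        using \<sigma>C by blast
    qed
    then show "\<exists>x. limitin MS.mtopology \<sigma> x sequentially" by blast
  qed
qed

end

lemma linear_isometryD:
  assumes "linear_isometry H K U"
  shows "x \<in> carrier H \<Longrightarrow> U x \<in> carrier K"
    and "\<lbrakk>x \<in> carrier H; y \<in> carrier H\<rbrakk> \<Longrightarrow> U (x \<oplus>\<^bsub>H\<^esub> y) = U x \<oplus>\<^bsub>K\<^esub> U y"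
    and "x \<in> carrier H \<Longrightarrow> U (c \<odot>\<^bsub>H\<^esub> x) = c \<odot>\<^bsub>K\<^esub> U x"
    and "\<lbrakk>x \<in> carrier H; y \<in> carrier H\<rbrakk> \<Longrightarrow> cinner K (U x) (U y) = cinner H x y"
  using assms by (auto simp: linear_isometry_def)

lemma linear_isometry_cdist:
  assumes "semi_inner_space H" "semi_inner_space K" and U: "linear_isometry H K U"
    and x: "x \<in> carrier H" and y: "y \<in> carrier H"
  shows "cdist K (U x) (U y) = cdist H x y"
proof -
  interpret H: semi_inner_space H by fact
  interpret K: semi_inner_space K by fact
  have "U x \<ominus>\<^bsub>K\<^esub> U y = U (x \<ominus>\<^bsub>H\<^esub> y)"
    using x y U by (simp add: H.minus_eq_smult K.minus_eq_smult linear_isometryD[OF U])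
  then show ?thesis
    using x y U by (simp add: H.cdist_eq K.cdist_eq cnorm_def linear_isometryD[OF U])
qed

context
  fixes V :: "('v, 'm) inner_space_scheme" and W :: "('w, 'n) inner_space_scheme" and f :: "'v \<Rightarrow> 'w"
  assumes V: "semi_inner_space V" and W: "semi_inner_space W" and f: "linear_isometry V W f"
begin

interpretation V: semi_inner_space V by (rule V)
interpretation W: semi_inner_space W by (rule W)

lemma isometry_cauchy_seqs: "s \<in> cauchy_seqs V \<Longrightarrow> (\<lambda>n. f (s n)) \<in> cauchy_seqs W"
  using linear_isometryD(1)[OF f] linear_isometry_cdist[OF V W f]
  by (auto simp: cauchy_seqs_def)

lemma completion_map_cls:
  assumes s: "s \<in> cauchy_seqs V"
  shows "completion_map V W f (null_rel V `` {s}) = null_rel W `` {\<lambda>n. f (s n)}"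
proof -
  have "(\<lambda>s. null_rel W `` {\<lambda>n. f (s n)}) respects null_rel V"
  proof (rule congruentI)
    fix s t assume "(s, t) \<in> null_rel V"
    then show "null_rel W `` {\<lambda>n. f (s n)} = null_rel W `` {\<lambda>n. f (t n)}"
      using linear_isometry_cdist[OF V W f]
      by (simp add: V.null_rel_iff W.cls_eq_iff isometry_cauchy_seqs V.csD)
  qed
  then show ?thesis
    using UN_equiv_class[OF V.equiv_null_rel _ s] V.cls_in[OF s] by (simp add: completion_map_def)
qed

lemma linear_isometry_completion_map:
  "linear_isometry (completion V) (completion W) (completion_map V W f)"
  unfolding linear_isometry_def
proof (intro conjI ballI allI)
  show "completion_map V W f \<in> carrier (completion V) \<rightarrow> carrier (completion W)"
    by (auto elim!: V.CH_cases simp: completion_map_cls isometry_cauchy_seqs)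
next
  fix S T assume "S \<in> carrier (completion V)" "T \<in> carrier (completion V)"
  then obtain s t where *: "s \<in> cauchy_seqs V" "S = null_rel V `` {s}"
      "t \<in> cauchy_seqs V" "T = null_rel V `` {t}"
    by (elim V.CH_cases)
  show "completion_map V W f (S \<oplus>\<^bsub>completion V\<^esub> T) =
      completion_map V W f S \<oplus>\<^bsub>completion W\<^esub> completion_map V W f T"
    using * by (simp add: V.add_cls W.add_cls completion_map_cls isometry_cauchy_seqs V.cs_add
        linear_isometryD(2)[OF f] V.csD)
  have "(\<lambda>n. cinner W (f (s n)) (f (t n))) \<longlonglongrightarrow> cinner (completion V) S T"
    using * V.cinner_cls[OF *(1) *(3)] by (simp add: linear_isometryD(4)[OF f] V.csD)
  then show "cinner (completion W) (completion_map V W f S) (completion_map V W f T) =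
      cinner (completion V) S T"
    using * by (simp add: completion_map_cls) (rule W.cinner_clsI, simp_all add: isometry_cauchy_seqs)
next
  fix c S assume "S \<in> carrier (completion V)"
  then obtain s where *: "s \<in> cauchy_seqs V" "S = null_rel V `` {s}" by (elim V.CH_cases)
  show "completion_map V W f (c \<odot>\<^bsub>completion V\<^esub> S) = c \<odot>\<^bsub>completion W\<^esub> completion_map V W f S"
    using * by (simp add: V.smult_cls W.smult_cls completion_map_cls isometry_cauchy_seqs V.cs_smult
        linear_isometryD(3)[OF f] V.csD)
qed

end

section \<open>Tensor products of Hilbert spaces\<close>

text \<open>Formal linear combinations of pairs \<open>(x, y)\<close> with the semi-inner product determined by
  \<open>((x, y) | (x', y')) = (x | x') (y | y')\<close>. Its Hausdorff completion is the Hilbert space tensor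
  product, the class of the pair \<open>(x, y)\<close> being the elementary tensor of \<open>x\<close> and \<open>y\<close>.\<close>

definition pre_tensor ::
  "('a, 'm) inner_space_scheme \<Rightarrow> ('b, 'n) inner_space_scheme \<Rightarrow> ('a \<times> 'b \<Rightarrow>\<^sub>0 complex) inner_space" where
  "pre_tensor H K = \<lparr>carrier = {f. Poly_Mapping.keys f \<subseteq> carrier H \<times> carrier K},
     monoid.mult = undefined, one = undefined, ring.zero = 0, add = (+),
     smult = (\<lambda>c. Poly_Mapping.map ((*) c)),
     cinner = (\<lambda>f g. \<Sum>p\<in>Poly_Mapping.keys f. \<Sum>q\<in>Poly_Mapping.keys g.
       Poly_Mapping.lookup f p * cnj (Poly_Mapping.lookup g q) *
         (cinner H (fst p) (fst q) * cinner K (snd p) (snd q)))\<rparr>"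

definition hilbert_tensor ::
  "('a, 'm) inner_space_scheme \<Rightarrow> ('b, 'n) inner_space_scheme \<Rightarrow>
    (nat \<Rightarrow> ('a \<times> 'b \<Rightarrow>\<^sub>0 complex)) set inner_space" where
  "hilbert_tensor H K = completion (pre_tensor H K)"

definition elem_tensor ::
  "('a, 'm) inner_space_scheme \<Rightarrow> ('b, 'n) inner_space_scheme \<Rightarrow> 'a \<Rightarrow> 'b \<Rightarrow>
    (nat \<Rightarrow> ('a \<times> 'b \<Rightarrow>\<^sub>0 complex)) set" where
  "elem_tensor H K x y = null_rel (pre_tensor H K) `` {\<lambda>n. Poly_Mapping.single (x, y) 1}"

definition pre_tensor_map :: "('a \<Rightarrow> 'c) \<Rightarrow> ('b \<Rightarrow> 'd) \<Rightarrow> ('a \<times> 'b \<Rightarrow>\<^sub>0 complex) \<Rightarrow> ('c \<times> 'd \<Rightarrow>\<^sub>0 complex)" where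
  "pre_tensor_map A B f =
     (\<Sum>p\<in>Poly_Mapping.keys f. Poly_Mapping.single (A (fst p), B (snd p)) (Poly_Mapping.lookup f p))"

text \<open>Meaningful for linear isometries \<open>A\<close> and \<open>B\<close>; see \<open>op_tensor_elem_tensor\<close> below.\<close>

definition op_tensor ::
  "('a, 'm) inner_space_scheme \<Rightarrow> ('b, 'n) inner_space_scheme \<Rightarrow> ('a \<Rightarrow> 'a) \<Rightarrow> ('b \<Rightarrow> 'b) \<Rightarrow>
    (nat \<Rightarrow> ('a \<times> 'b \<Rightarrow>\<^sub>0 complex)) set \<Rightarrow> (nat \<Rightarrow> ('a \<times> 'b \<Rightarrow>\<^sub>0 complex)) set" where
  "op_tensor H K A B = completion_map (pre_tensor H K) (pre_tensor H K) (pre_tensor_map A B)"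

definition lin_ext :: "('p \<Rightarrow> complex) \<Rightarrow> ('p \<Rightarrow>\<^sub>0 complex) \<Rightarrow> complex" where
  "lin_ext \<phi> f = (\<Sum>p\<in>Poly_Mapping.keys f. Poly_Mapping.lookup f p * \<phi> p)"

lemma lin_ext_superset:
  assumes "finite S" "Poly_Mapping.keys f \<subseteq> S"
  shows "lin_ext \<phi> f = (\<Sum>p\<in>S. Poly_Mapping.lookup f p * \<phi> p)"
  unfolding lin_ext_def by (rule sum.mono_neutral_left) (use assms in \<open>auto simp: in_keys_iff\<close>)

lemma lin_ext_zero [simp]: "lin_ext \<phi> 0 = 0"
  by (simp add: lin_ext_def)

lemma lin_ext_add: "lin_ext \<phi> (f + g) = lin_ext \<phi> f + lin_ext \<phi> g"
proof -
  let ?S = "Poly_Mapping.keys f \<union> Poly_Mapping.keys g"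
  have "lin_ext \<phi> (f + g) = (\<Sum>p\<in>?S. Poly_Mapping.lookup (f + g) p * \<phi> p)"
    by (rule lin_ext_superset) (simp_all add: Poly_Mapping.keys_add)
  also have "\<dots> = (\<Sum>p\<in>?S. Poly_Mapping.lookup f p * \<phi> p) + (\<Sum>p\<in>?S. Poly_Mapping.lookup g p * \<phi> p)"
    by (simp add: lookup_add distrib_right sum.distrib)
  also have "\<dots> = lin_ext \<phi> f + lin_ext \<phi> g"
    using lin_ext_superset[of ?S f \<phi>] lin_ext_superset[of ?S g \<phi>] by simp
  finally show ?thesis .
qed

lemma lin_ext_sum: "lin_ext \<phi> (sum F S) = (\<Sum>s\<in>S. lin_ext \<phi> (F s))"
  by (induction S rule: infinite_finite_induct) (simp_all add: lin_ext_add)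

lemma lookup_scale: "Poly_Mapping.lookup (Poly_Mapping.map ((*) c) f) p = c * Poly_Mapping.lookup f p"
  for c :: complex
  by (simp add: Poly_Mapping.map.rep_eq when_def)

lemma keys_scale: "Poly_Mapping.keys (Poly_Mapping.map ((*) c) f) \<subseteq> Poly_Mapping.keys f"
  for c :: complex
  by (auto simp: in_keys_iff lookup_scale)

lemma lin_ext_scale: "lin_ext \<phi> (Poly_Mapping.map ((*) c) f) = c * lin_ext \<phi> f"
proof -
  have "lin_ext \<phi> (Poly_Mapping.map ((*) c) f)
      = (\<Sum>p\<in>Poly_Mapping.keys f. Poly_Mapping.lookup (Poly_Mapping.map ((*) c) f) p * \<phi> p)"
    by (rule lin_ext_superset) (simp_all add: keys_scale)
  then show ?thesis by (simp add: lookup_scale lin_ext_def sum_distrib_left mult.assoc)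
qed

lemma lin_ext_single: "lin_ext \<phi> (Poly_Mapping.single p c) = c * \<phi> p"
  using lin_ext_superset[of "{p}" "Poly_Mapping.single p c" \<phi>] by simp

lemma lin_ext_cong: "(\<And>p. p \<in> Poly_Mapping.keys f \<Longrightarrow> \<phi> p = \<psi> p) \<Longrightarrow> lin_ext \<phi> f = lin_ext \<psi> f"
  by (simp add: lin_ext_def)

lemma lin_ext_pre_tensor_map:
  "lin_ext \<phi> (pre_tensor_map A B f) = lin_ext (\<lambda>p. \<phi> (A (fst p), B (snd p))) f"
  by (simp add: pre_tensor_map_def lin_ext_sum lin_ext_single) (simp add: lin_ext_def)

lemma lookup_eq_lin_ext: "Poly_Mapping.lookup f r = lin_ext (\<lambda>p. of_bool (p = r)) f"
proof -
  have "lin_ext (\<lambda>p. of_bool (p = r)) f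
      = (\<Sum>p\<in>insert r (Poly_Mapping.keys f). Poly_Mapping.lookup f p * of_bool (p = r))"
    by (rule lin_ext_superset) auto
  also have "\<dots> = (\<Sum>p\<in>insert r (Poly_Mapping.keys f). if p = r then Poly_Mapping.lookup f p else 0)"
    by (rule sum.cong) auto
  finally show ?thesis by simp
qed

lemma poly_mapping_eq_lin_extI: "(\<And>\<phi>. lin_ext \<phi> f = lin_ext \<phi> g) \<Longrightarrow> f = g"
  by (rule poly_mapping_eqI) (simp add: lookup_eq_lin_ext)

lemma pre_tensor_map_add: "pre_tensor_map A B (f + g) = pre_tensor_map A B f + pre_tensor_map A B g"
  by (rule poly_mapping_eq_lin_extI) (simp add: lin_ext_add lin_ext_pre_tensor_map)

lemma pre_tensor_map_scale:
  "pre_tensor_map A B (Poly_Mapping.map ((*) c) f) = Poly_Mapping.map ((*) c) (pre_tensor_map A B f)"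
  by (rule poly_mapping_eq_lin_extI) (simp add: lin_ext_scale lin_ext_pre_tensor_map)

lemma pre_tensor_map_comp:
  "pre_tensor_map A B (pre_tensor_map C D f) = pre_tensor_map (\<lambda>x. A (C x)) (\<lambda>y. B (D y)) f"
  by (rule poly_mapping_eq_lin_extI) (simp add: lin_ext_pre_tensor_map)

lemma pre_tensor_map_single:
  "pre_tensor_map A B (Poly_Mapping.single (x, y) c) = Poly_Mapping.single (A x, B y) c"
  by (rule poly_mapping_eq_lin_extI) (simp add: lin_ext_single lin_ext_pre_tensor_map)

lemma pre_tensor_map_cong:
  assumes "Poly_Mapping.keys f \<subseteq> S \<times> T" "\<And>x. x \<in> S \<Longrightarrow> A x = A' x" "\<And>y. y \<in> T \<Longrightarrow> B y = B' y"
  shows "pre_tensor_map A B f = pre_tensor_map A' B' f"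
  unfolding pre_tensor_map_def by (rule sum.cong) (use assms in auto)

lemma pre_tensor_map_id:
  assumes "Poly_Mapping.keys f \<subseteq> S \<times> T" "\<And>x. x \<in> S \<Longrightarrow> A x = x" "\<And>y. y \<in> T \<Longrightarrow> B y = y"
  shows "pre_tensor_map A B f = f"
proof -
  have "pre_tensor_map A B f = pre_tensor_map (\<lambda>x. x) (\<lambda>y. y) f"
    by (rule pre_tensor_map_cong) (use assms in auto)
  also have "\<dots> = f" by (rule poly_mapping_eq_lin_extI) (simp add: lin_ext_pre_tensor_map)
  finally show ?thesis .
qed

lemma keys_pre_tensor_map:
  assumes "Poly_Mapping.keys f \<subseteq> S \<times> T" "A \<in> S \<rightarrow> S'" "B \<in> T \<rightarrow> T'"
  shows "Poly_Mapping.keys (pre_tensor_map A B f) \<subseteq> S' \<times> T'"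
proof
  fix r assume "r \<in> Poly_Mapping.keys (pre_tensor_map A B f)"
  then have ne: "lin_ext (\<lambda>p. of_bool ((A (fst p), B (snd p)) = r)) f \<noteq> 0"
    using lookup_eq_lin_ext[of "pre_tensor_map A B f" r] by (simp add: lin_ext_pre_tensor_map in_keys_iff)
  have "\<exists>p\<in>Poly_Mapping.keys f. (A (fst p), B (snd p)) = r"
  proof (rule ccontr)
    assume "\<not> ?thesis"
    then have "lin_ext (\<lambda>p. of_bool ((A (fst p), B (snd p)) = r)) f = lin_ext (\<lambda>p. 0) f"
      by (intro lin_ext_cong) auto
    then show False using ne by (simp add: lin_ext_def)
  qed
  then show "r \<in> S' \<times> T'" using assms by auto
qed

lemma pre_tensor_simps [simp]:
  "f \<in> carrier (pre_tensor H K) \<longleftrightarrow> Poly_Mapping.keys f \<subseteq> carrier H \<times> carrier K"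
  "\<zero>\<^bsub>pre_tensor H K\<^esub> = 0" "f \<oplus>\<^bsub>pre_tensor H K\<^esub> g = f + g"
  "c \<odot>\<^bsub>pre_tensor H K\<^esub> f = Poly_Mapping.map ((*) c) f"
  by (simp_all add: pre_tensor_def)

lemma cinner_pre_tensor:
  "cinner (pre_tensor H K) f g =
     lin_ext (\<lambda>p. cnj (lin_ext (\<lambda>q. cnj (cinner H (fst p) (fst q) * cinner K (snd p) (snd q))) g)) f"
  by (simp add: pre_tensor_def lin_ext_def sum_distrib_left mult.assoc)

lemma (in inner_product_space) psd_kernel_times_cinner:
  fixes k :: "'p \<Rightarrow> 'p \<Rightarrow> complex"
  assumes "finite S" and k: "\<And>c. 0 \<le> Re (\<Sum>p\<in>S. \<Sum>q\<in>S. c p * cnj (c q) * k p q)"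
    and "y \<in> S \<rightarrow> carrier H"
  shows "0 \<le> Re (\<Sum>p\<in>S. \<Sum>q\<in>S. c p * cnj (c q) * (k p q * cinner H (y p) (y q)))"
  using assms
proof (induction S arbitrary: y rule: finite_induct)
  case (insert a S)
  define d where "d = Re (cinner H (y a) (y a))"
  have ya: "y a \<in> carrier H" and yS: "\<And>p. p \<in> S \<Longrightarrow> y p \<in> carrier H" using insert.prems by auto
  have yI: "\<And>p. p \<in> insert a S \<Longrightarrow> y p \<in> carrier H" using ya yS by auto
  have d: "cinner H (y a) (y a) = of_real d" "d \<ge> 0"
    using cinner_self_real[OF ya] cinner_nonneg[OF ya] by (auto simp: d_def)
  define z where "z p = y p \<ominus> (cinner H (y p) (y a) / of_real d) \<odot> y a" for p
  have zI: "z p \<in> carrier H" if "p \<in> insert a S" for p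
    using yI[OF that] ya by (simp add: z_def)
  have ya0: "cinner H (y p) (y a) = 0" "cinner H (y a) (y p) = 0" if "d = 0" "p \<in> insert a S" for p
  proof -
    have "y a = \<zero>" using cinner_definite[OF ya] d that by simp
    then have "y a = 0 \<odot> y a" using ya smult_l_null[of "y a"] by simp
    then show "cinner H (y p) (y a) = 0" "cinner H (y a) (y p) = 0"
      using yI[OF that(2)] ya cinner_scale_left[of "y a" "y p" 0] cinner_scale_right[of "y a" "y p" 0]
      by auto
  qed
  have split: "cinner H (y p) (y q) = cinner H (z p) (z q) +
      cinner H (y p) (y a) * cnj (cinner H (y q) (y a)) / of_real d"
    if pq: "p \<in> insert a S" "q \<in> insert a S" for p q
  proof -
    have c: "cinner H (y a) (y q) = cnj (cinner H (y q) (y a))"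
      using yI pq ya by (intro cinner_commute) auto
    show ?thesis
    proof (cases "d = 0")
      case True
      then show ?thesis
        using yI[OF pq(1)] yI[OF pq(2)] ya ya0[OF True pq(1)] ya0[OF True pq(2)]
        by (simp add: z_def cinner_simps)
    next
      case False
      then show ?thesis
        using yI[OF pq(1)] yI[OF pq(2)] ya
        by (simp add: z_def cinner_simps c d(1) field_simps)
    qed
  qed
  have za: "cinner H (z a) (z p) = 0" "cinner H (z p) (z a) = 0" if p: "p \<in> insert a S" for p
  proof -
    have "cinner H (z a) (z a) = 0"
    proof (cases "d = 0")
      case True
      then show ?thesis using split[of a a] d by simp
    next
      case False
      then show ?thesis using split[of a a] d by simp
    qed
    then have "z a = \<zero>" using cinner_definite zI by blast
    then have "z a = 0 \<odot> z a" using smult_l_null[of "z a"] zI[of a] by simp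
    then show "cinner H (z a) (z p) = 0" "cinner H (z p) (z a) = 0"
      using zI[OF p] zI[of a] cinner_scale_left[of "z a" "z p" 0] cinner_scale_right[of "z a" "z p" 0]
      by auto
  qed
  have kS: "0 \<le> Re (\<Sum>p\<in>S. \<Sum>q\<in>S. c p * cnj (c q) * k p q)" for c
    using insert.prems(1)[of "\<lambda>p. if p = a then 0 else c p"] insert.hyps
    by (simp add: sum.insert cong: if_cong) (smt (verit, best) sum.cong)
  let ?T = "\<lambda>f. \<Sum>p\<in>insert a S. \<Sum>q\<in>insert a S. c p * cnj (c q) * (k p q * f p q)"
  have "?T (\<lambda>p q. cinner H (y p) (y q)) =
      ?T (\<lambda>p q. cinner H (z p) (z q) + cinner H (y p) (y a) * cnj (cinner H (y q) (y a)) / of_real d)"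
    by (intro sum.cong refl arg_cong2[where f = "(*)"] split)
  also have "\<dots> = ?T (\<lambda>p q. cinner H (z p) (z q)) +
      ?T (\<lambda>p q. cinner H (y p) (y a) * cnj (cinner H (y q) (y a)) / of_real d)"
    by (simp only: distrib_left sum.distrib)
  also have "?T (\<lambda>p q. cinner H (z p) (z q)) =
      (\<Sum>p\<in>S. \<Sum>q\<in>S. c p * cnj (c q) * (k p q * cinner H (z p) (z q)))"
    using insert.hyps za by (simp add: sum.insert)
  also have "?T (\<lambda>p q. cinner H (y p) (y a) * cnj (cinner H (y q) (y a)) / of_real d) =
      (\<Sum>p\<in>insert a S. \<Sum>q\<in>insert a S.
        (c p * cinner H (y p) (y a)) * cnj (c q * cinner H (y q) (y a)) * k p q) / of_real d"
    unfolding sum_divide_distrib by (intro sum.cong refl) (simp add: mult_ac)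
  finally have eq: "?T (\<lambda>p q. cinner H (y p) (y q)) =
      (\<Sum>p\<in>S. \<Sum>q\<in>S. c p * cnj (c q) * (k p q * cinner H (z p) (z q))) +
      (\<Sum>p\<in>insert a S. \<Sum>q\<in>insert a S.
        (c p * cinner H (y p) (y a)) * cnj (c q * cinner H (y q) (y a)) * k p q) / of_real d" .
  have "0 \<le> Re (\<Sum>p\<in>S. \<Sum>q\<in>S. c p * cnj (c q) * (k p q * cinner H (z p) (z q)))"
    using zI by (intro insert.IH kS) auto
  moreover have "0 \<le> Re ((\<Sum>p\<in>insert a S. \<Sum>q\<in>insert a S.
        (c p * cinner H (y p) (y a)) * cnj (c q * cinner H (y q) (y a)) * k p q) / of_real d)"
    using insert.prems(1)[of "\<lambda>p. c p * cinner H (y p) (y a)"] d(2)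
    by (simp only: Re_divide_of_real) (rule divide_nonneg_nonneg)
  ultimately show ?case unfolding eq by simp
qed simp

lemma semi_inner_space_pre_tensor:
  fixes H :: "('a, 'm) inner_space_scheme" and K :: "('b, 'n) inner_space_scheme"
  assumes "inner_product_space H" "inner_product_space K"
  shows "semi_inner_space (pre_tensor H K)"
proof (intro semi_inner_space.intro semi_inner_space_axioms.intro)
  interpret H: inner_product_space H by fact
  interpret K: inner_product_space K by fact
  let ?V = "pre_tensor H K"
  show "module complex_field ?V"
  proof (rule moduleI)
    show "abelian_group ?V"
    proof (rule abelian_groupI)
      fix f g assume "f \<in> carrier ?V" "g \<in> carrier ?V"
      then show "f \<oplus>\<^bsub>?V\<^esub> g \<in> carrier ?V" using Poly_Mapping.keys_add[of f g] by auto
    next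
      fix f assume f: "f \<in> carrier ?V"
      then show "\<exists>g\<in>carrier ?V. g \<oplus>\<^bsub>?V\<^esub> f = \<zero>\<^bsub>?V\<^esub>"
        by (intro bexI[of _ "- f"]) (auto simp: in_keys_iff)
    qed (simp_all add: add_ac)
  next
    fix c f assume "f \<in> carrier ?V"
    then show "c \<odot>\<^bsub>?V\<^esub> f \<in> carrier ?V" using keys_scale[of c f] by auto
  qed (auto intro!: poly_mapping_eqI simp: cring_complex_field lookup_scale lookup_add algebra_simps)
next
  let ?V = "pre_tensor H K"
  interpret H: inner_product_space H by fact
  interpret K: inner_product_space K by fact
  show "cinner ?V (f \<oplus>\<^bsub>?V\<^esub> g) h = cinner ?V f h + cinner ?V g h" for f g h
    by (simp add: cinner_pre_tensor lin_ext_add)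
  show "cinner ?V (c \<odot>\<^bsub>?V\<^esub> f) h = c * cinner ?V f h" for c f h
    by (simp add: cinner_pre_tensor lin_ext_scale)
  {
    fix f g assume fg: "f \<in> carrier ?V" "g \<in> carrier ?V"
    have c: "cinner H (fst p) (fst q) * cinner K (snd p) (snd q) =
        cnj (cinner H (fst q) (fst p) * cinner K (snd q) (snd p))"
      if "p \<in> Poly_Mapping.keys f" "q \<in> Poly_Mapping.keys g" for p q
    proof -
      have "fst p \<in> carrier H" "snd p \<in> carrier K" "fst q \<in> carrier H" "snd q \<in> carrier K"
        using fg that by (auto simp: mem_Times_iff subset_eq)
      then show ?thesis
        using H.cinner_commute[of "fst p" "fst q"] K.cinner_commute[of "snd p" "snd q"] by simp
    qed
    have "cinner ?V f g = (\<Sum>p\<in>Poly_Mapping.keys f. \<Sum>q\<in>Poly_Mapping.keys g.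
        cnj (Poly_Mapping.lookup g q * cnj (Poly_Mapping.lookup f p) *
          (cinner H (fst q) (fst p) * cinner K (snd q) (snd p))))"
      unfolding pre_tensor_def inner_space.simps
      by (intro sum.cong refl) (simp only: c complex_cnj_mult complex_cnj_cnj mult_ac)
    also have "\<dots> = (\<Sum>q\<in>Poly_Mapping.keys g. \<Sum>p\<in>Poly_Mapping.keys f.
        cnj (Poly_Mapping.lookup g q * cnj (Poly_Mapping.lookup f p) *
          (cinner H (fst q) (fst p) * cinner K (snd q) (snd p))))"
      by (rule sum.swap)
    also have "\<dots> = cnj (cinner ?V g f)"
      unfolding pre_tensor_def inner_space.simps by (simp only: cnj_sum)
    finally show "cinner ?V f g = cnj (cinner ?V g f)" .
  }
  fix f assume f: "f \<in> carrier ?V"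
  let ?S = "Poly_Mapping.keys f"
  have 1: "0 \<le> Re (\<Sum>p\<in>?S. \<Sum>q\<in>?S. c p * cnj (c q) * 1)" for c :: "'a \<times> 'b \<Rightarrow> complex"
  proof -
    have eq: "(\<Sum>p\<in>?S. \<Sum>q\<in>?S. c p * cnj (c q) * 1) = (\<Sum>p\<in>?S. c p) * cnj (\<Sum>q\<in>?S. c q)"
      by (simp add: sum_product)
    have nn: "0 \<le> Re (z * cnj z)" for z by (simp add: complex_mult_cnj)
    show ?thesis unfolding eq by (rule nn)
  qed
  have fs: "fst \<in> ?S \<rightarrow> carrier H" "snd \<in> ?S \<rightarrow> carrier K" using f by auto
  have 2: "0 \<le> Re (\<Sum>p\<in>?S. \<Sum>q\<in>?S. c p * cnj (c q) * cinner H (fst p) (fst q))" for c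
    using H.psd_kernel_times_cinner[OF finite_keys 1 fs(1), of c] by (simp only: mult_1_left)
  show "0 \<le> Re (cinner ?V f f)"
    unfolding pre_tensor_def inner_space.simps
    by (rule K.psd_kernel_times_cinner[OF finite_keys 2 fs(2)])
qed

theorem hilbert_space_hilbert_tensor:
  assumes "inner_product_space H" "inner_product_space K"
  shows "hilbert_space (hilbert_tensor H K)"
  unfolding hilbert_tensor_def
  by (intro semi_inner_space.hilbert_space_completion semi_inner_space_pre_tensor assms)

context
  fixes H :: "('a, 'm) inner_space_scheme" and K :: "('b, 'n) inner_space_scheme"
  assumes H: "inner_product_space H" and K: "inner_product_space K"
begin

interpretation H: inner_product_space H by (rule H)
interpretation K: inner_product_space K by (rule K)
interpretation V: semi_inner_space "pre_tensor H K" by (rule semi_inner_space_pre_tensor[OF H K])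
interpretation T: hilbert_space "hilbert_tensor H K" by (rule hilbert_space_hilbert_tensor[OF H K])

lemma single_cauchy_seqs:
  "\<lbrakk>x \<in> carrier H; y \<in> carrier K\<rbrakk> \<Longrightarrow>
    (\<lambda>n. Poly_Mapping.single (x, y) 1) \<in> cauchy_seqs (pre_tensor H K)"
  by simp

lemma elem_tensor_closed:
  "\<lbrakk>x \<in> carrier H; y \<in> carrier K\<rbrakk> \<Longrightarrow> elem_tensor H K x y \<in> carrier (hilbert_tensor H K)"
  unfolding elem_tensor_def hilbert_tensor_def by (intro V.cls_in single_cauchy_seqs)

lemma cinner_elem_tensor:
  assumes "x \<in> carrier H" "y \<in> carrier K" "x' \<in> carrier H" "y' \<in> carrier K"
  shows "cinner (hilbert_tensor H K) (elem_tensor H K x y) (elem_tensor H K x' y')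
    = cinner H x x' * cinner K y y'"
  unfolding elem_tensor_def hilbert_tensor_def
  by (rule V.cinner_clsI)
    (use assms in \<open>simp_all add: single_cauchy_seqs cinner_pre_tensor lin_ext_single\<close>)

text \<open>The elementary tensors span a dense subspace.\<close>

lemma elem_tensor_total:
  assumes "T \<in> carrier (hilbert_tensor H K)"
    and 0: "\<And>x y. \<lbrakk>x \<in> carrier H; y \<in> carrier K\<rbrakk> \<Longrightarrow>
      cinner (hilbert_tensor H K) (elem_tensor H K x y) T = 0"
  shows "T = \<zero>\<^bsub>hilbert_tensor H K\<^esub>"
proof (rule T.cinner_definite)
  show T: "T \<in> carrier (hilbert_tensor H K)" by fact
  obtain t where t: "t \<in> cauchy_seqs (pre_tensor H K)" "T = null_rel (pre_tensor H K) `` {t}"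
    using V.CH_cases T unfolding hilbert_tensor_def by metis
  let ?c = "\<lambda>f. null_rel (pre_tensor H K) `` {\<lambda>n::nat. f}"
  have conv: "(\<lambda>n. cinner (pre_tensor H K) f (t n)) \<longlonglongrightarrow> 0" if f: "f \<in> carrier (pre_tensor H K)" for f
  proof -
    have s: "(\<lambda>n. cinner (pre_tensor H K) (Poly_Mapping.single p 1) (t n)) \<longlonglongrightarrow> 0"
      if pf: "p \<in> Poly_Mapping.keys f" for p
    proof -
      obtain x y where p: "p = (x, y)" "x \<in> carrier H" "y \<in> carrier K"
        using pf f by (cases p) auto
      show ?thesis
        using V.cinner_cls[OF single_cauchy_seqs[OF p(2,3)] t(1)] 0[OF p(2,3)] t(2)
        by (simp add: p(1) elem_tensor_def hilbert_tensor_def)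
    qed
    have "(\<lambda>n. \<Sum>p\<in>Poly_Mapping.keys f. Poly_Mapping.lookup f p *
        cinner (pre_tensor H K) (Poly_Mapping.single p 1) (t n)) \<longlonglongrightarrow> 0"
      by (intro tendsto_null_sum tendsto_mult_right_zero s)
    moreover have "cinner (pre_tensor H K) f (t n) = (\<Sum>p\<in>Poly_Mapping.keys f. Poly_Mapping.lookup f p *
        cinner (pre_tensor H K) (Poly_Mapping.single p 1) (t n))" for n
      by (simp add: cinner_pre_tensor lin_ext_single) (simp add: lin_ext_def)
    ultimately show ?thesis by simp
  qed
  have "cinner (completion (pre_tensor H K)) (?c (t m)) T = 0" for m
    unfolding t(2) by (rule V.cinner_clsI) (use t V.csD conv in \<open>blast intro: V.cs_const\<close>)+
  moreover have "(\<lambda>m. cinner (completion (pre_tensor H K)) (?c (t m)) T)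
      \<longlonglongrightarrow> cinner (completion (pre_tensor H K)) T T"
  proof -
    have T': "T \<in> carrier V.CH" using T by (simp add: hilbert_tensor_def)
    have c: "?c (t m) \<in> carrier V.CH" for m using V.csD[OF t(1)] by (intro V.cls_in V.cs_const)
    interpret C: hilbert_space V.CH by (rule V.hilbert_space_completion)
    have "(\<lambda>m. cdist V.CH (?c (t m)) T) \<longlonglongrightarrow> 0"
    proof (rule LIMSEQ_I)
      fix e :: real assume e: "e > 0"
      obtain N where N: "\<And>m n. m \<ge> N \<Longrightarrow> n \<ge> N \<Longrightarrow> cdist (pre_tensor H K) (t m) (t n) < e / 2"
        using V.csE[OF t(1), of "e / 2"] e by auto
      have "cdist V.CH (?c (t m)) T < e" if "m \<ge> N" for m
      proof -
        have "(\<lambda>n. cdist (pre_tensor H K) (t m) (t n)) \<longlonglongrightarrow> cdist V.CH (?c (t m)) T"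
          unfolding t(2) by (intro V.cdist_cls t V.cs_const V.csD[OF t(1)])
        then have "cdist V.CH (?c (t m)) T \<le> e / 2"
          by (rule LIMSEQ_le_const2) (use N[OF that] in \<open>auto intro!: exI[of _ N] less_imp_le\<close>)
        then show ?thesis using e by simp
      qed
      then show "\<exists>N. \<forall>m\<ge>N. norm (cdist V.CH (?c (t m)) T - 0) < e" by auto
    qed
    then have lim: "(\<lambda>m. cdist V.CH (?c (t m)) T * cnorm V.CH T) \<longlonglongrightarrow> 0"
      by (rule tendsto_mult_left_zero)
    have "(\<lambda>m. cmod (cinner V.CH (?c (t m)) T - cinner V.CH T T)) \<longlonglongrightarrow> 0"
      by (rule null_sequence_squeeze[OF lim])
        (use C.cinner_diff_bound[OF c T' T' T'] C.cdist_self[of T] in simp_all)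
    then have "(\<lambda>m. cinner V.CH (?c (t m)) T - cinner V.CH T T) \<longlonglongrightarrow> 0"
      by (rule tendsto_norm_zero_cancel)
    then show ?thesis by (rule LIM_zero_cancel)
  qed
  ultimately show "cinner (hilbert_tensor H K) T T = 0"
    by (simp add: hilbert_tensor_def LIMSEQ_const_iff)
qed

lemma linear_isometry_pre_tensor_map:
  assumes A: "linear_isometry H H A" and B: "linear_isometry K K B"
  shows "linear_isometry (pre_tensor H K) (pre_tensor H K) (pre_tensor_map A B)"
  unfolding linear_isometry_def
proof (intro conjI ballI allI)
  show "pre_tensor_map A B \<in> carrier (pre_tensor H K) \<rightarrow> carrier (pre_tensor H K)"
    using A B keys_pre_tensor_map[of _ "carrier H" "carrier K" A "carrier H" B "carrier K"]
    by (auto simp: linear_isometry_def)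
next
  fix f g assume fg: "f \<in> carrier (pre_tensor H K)" "g \<in> carrier (pre_tensor H K)"
  have "cinner H (A (fst p)) (A (fst q)) * cinner K (B (snd p)) (B (snd q)) =
      cinner H (fst p) (fst q) * cinner K (snd p) (snd q)"
    if "p \<in> Poly_Mapping.keys f" "q \<in> Poly_Mapping.keys g" for p q
  proof -
    have "fst p \<in> carrier H" "snd p \<in> carrier K" "fst q \<in> carrier H" "snd q \<in> carrier K"
      using fg that by (auto simp: mem_Times_iff subset_eq)
    then show ?thesis using linear_isometryD(4)[OF A] linear_isometryD(4)[OF B] by simp
  qed
  then show "cinner (pre_tensor H K) (pre_tensor_map A B f) (pre_tensor_map A B g) =
      cinner (pre_tensor H K) f g"
    unfolding cinner_pre_tensor lin_ext_pre_tensor_map fst_conv snd_conv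
    by (intro lin_ext_cong arg_cong[where f = cnj]) simp
qed (simp_all add: pre_tensor_map_add pre_tensor_map_scale)

lemma linear_isometry_op_tensor:
  assumes "linear_isometry H H A" "linear_isometry K K B"
  shows "linear_isometry (hilbert_tensor H K) (hilbert_tensor H K) (op_tensor H K A B)"
  unfolding op_tensor_def hilbert_tensor_def
  by (intro linear_isometry_completion_map V.semi_inner_space_axioms linear_isometry_pre_tensor_map assms)

lemma op_tensor_cls:
  assumes "linear_isometry H H A" "linear_isometry K K B" "s \<in> cauchy_seqs (pre_tensor H K)"
  shows "op_tensor H K A B (null_rel (pre_tensor H K) `` {s}) =
    null_rel (pre_tensor H K) `` {\<lambda>n. pre_tensor_map A B (s n)}"
  unfolding op_tensor_def
  by (intro completion_map_cls V.semi_inner_space_axioms linear_isometry_pre_tensor_map assms)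

lemma op_tensor_elem_tensor:
  assumes "linear_isometry H H A" "linear_isometry K K B" "x \<in> carrier H" "y \<in> carrier K"
  shows "op_tensor H K A B (elem_tensor H K x y) = elem_tensor H K (A x) (B y)"
  using assms by (simp add: elem_tensor_def op_tensor_cls single_cauchy_seqs pre_tensor_map_single)

lemma op_tensor_compose:
  assumes "linear_isometry H H A" "linear_isometry K K B" "linear_isometry H H A'" "linear_isometry K K B'"
    and "linear_isometry H H A''" "linear_isometry K K B''"
    and A'': "\<And>x. x \<in> carrier H \<Longrightarrow> A'' x = A (A' x)"
    and B'': "\<And>y. y \<in> carrier K \<Longrightarrow> B'' y = B (B' y)"
    and S: "S \<in> carrier (hilbert_tensor H K)"
  shows "op_tensor H K A B (op_tensor H K A' B' S) = op_tensor H K A'' B'' S"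
proof -
  obtain s where s: "s \<in> cauchy_seqs (pre_tensor H K)" "S = null_rel (pre_tensor H K) `` {s}"
    using V.CH_cases S unfolding hilbert_tensor_def by metis
  have "pre_tensor_map A B (pre_tensor_map A' B' (s n)) = pre_tensor_map A'' B'' (s n)" for n
    unfolding pre_tensor_map_comp
    by (rule pre_tensor_map_cong[of _ "carrier H" "carrier K"]) (use V.csD[OF s(1), of n] A'' B'' in simp_all)
  then show ?thesis
    using assms(1-6) s
    by (simp add: op_tensor_cls isometry_cauchy_seqs[OF V.semi_inner_space_axioms
          V.semi_inner_space_axioms linear_isometry_pre_tensor_map])
qed

lemma op_tensor_id:
  assumes "linear_isometry H H A" "linear_isometry K K B"
    and "\<And>x. x \<in> carrier H \<Longrightarrow> A x = x" "\<And>y. y \<in> carrier K \<Longrightarrow> B y = y"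
    and S: "S \<in> carrier (hilbert_tensor H K)"
  shows "op_tensor H K A B S = S"
proof -
  obtain s where s: "s \<in> cauchy_seqs (pre_tensor H K)" "S = null_rel (pre_tensor H K) `` {s}"
    using V.CH_cases S unfolding hilbert_tensor_def by metis
  have "pre_tensor_map A B (s n) = s n" for n
    by (rule pre_tensor_map_id[of _ "carrier H" "carrier K"]) (use V.csD[OF s(1), of n] assms in simp_all)
  then show ?thesis using assms(1,2) s by (simp add: op_tensor_cls)
qed

end

section \<open>Unitary representations\<close>

definition unitary_group :: "('a, 'm) inner_space_scheme \<Rightarrow> ('a \<Rightarrow> 'a) monoid" where
  "unitary_group H = BijGroup (carrier H)\<lparr>carrier := {U \<in> Bij (carrier H). linear_isometry H H U}\<rparr>"

definition unitary_rep ::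
  "('g, 'k) monoid_scheme \<Rightarrow> ('a, 'm) inner_space_scheme \<Rightarrow> ('g \<Rightarrow> 'a \<Rightarrow> 'a) \<Rightarrow> bool" where
  "unitary_rep G H \<pi> \<longleftrightarrow> hilbert_space H \<and> \<pi> \<in> hom G (unitary_group H)"

definition unitarily_equivalent ::
  "('g, 'k) monoid_scheme \<Rightarrow> ('a, 'm) inner_space_scheme \<Rightarrow> ('g \<Rightarrow> 'a \<Rightarrow> 'a) \<Rightarrow>
    ('b, 'n) inner_space_scheme \<Rightarrow> ('g \<Rightarrow> 'b \<Rightarrow> 'b) \<Rightarrow> bool" where
  "unitarily_equivalent G H \<pi> K \<sigma> \<longleftrightarrow>
     (\<exists>U. linear_isometry H K U \<and> U ` carrier H = carrier K \<and>
       (\<forall>g\<in>carrier G. \<forall>x\<in>carrier H. U (\<pi> g x) = \<sigma> g (U x)))"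

definition phi_tensor ::
  "nat \<Rightarrow> nat \<Rightarrow> ('a, 'm) inner_space_scheme \<Rightarrow> ('b, 'n) inner_space_scheme \<Rightarrow>
    (letter list \<Rightarrow> 'a \<Rightarrow> 'a) \<Rightarrow> (letter list \<Rightarrow> 'b \<Rightarrow> 'b) \<Rightarrow>
    letter list \<Rightarrow> (nat \<Rightarrow> ('a \<times> 'b \<Rightarrow>\<^sub>0 complex)) set \<Rightarrow> (nat \<Rightarrow> ('a \<times> 'b \<Rightarrow>\<^sub>0 complex)) set" where
  "phi_tensor n m H K \<pi> \<pi>' g =
     op_tensor H K (\<pi> (fst (phi_hom n m g))) (\<pi>' (snd (phi_hom n m g)))"

lemma unitary_group_simps:
  "U \<in> carrier (unitary_group H) \<longleftrightarrow> U \<in> Bij (carrier H) \<and> linear_isometry H H U"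
  "\<one>\<^bsub>unitary_group H\<^esub> = (\<lambda>x\<in>carrier H. x)"
  "\<lbrakk>U \<in> Bij (carrier H); V \<in> Bij (carrier H)\<rbrakk> \<Longrightarrow> U \<otimes>\<^bsub>unitary_group H\<^esub> V = compose (carrier H) U V"
  by (simp_all add: unitary_group_def BijGroup_def)

lemma linear_isometry_cong:
  assumes "semi_inner_space H" "linear_isometry H K U" "\<And>x. x \<in> carrier H \<Longrightarrow> V x = U x"
  shows "linear_isometry H K V"
proof -
  interpret H: semi_inner_space H by fact
  show ?thesis using assms(2,3) by (auto simp: linear_isometry_def Pi_iff)
qed

theorem group_unitary_group:
  assumes "semi_inner_space H"
  shows "group (unitary_group H)"
proof -
  interpret H: semi_inner_space H by fact
  interpret B: group "BijGroup (carrier H)" by (rule group_BijGroup)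
  have B1: "\<one>\<^bsub>BijGroup (carrier H)\<^esub> = (\<lambda>x\<in>carrier H. x)"
    "carrier (BijGroup (carrier H)) = Bij (carrier H)"
    "\<And>U V. \<lbrakk>U \<in> Bij (carrier H); V \<in> Bij (carrier H)\<rbrakk> \<Longrightarrow>
      U \<otimes>\<^bsub>BijGroup (carrier H)\<^esub> V = compose (carrier H) U V"
    by (simp_all add: BijGroup_def)
  have "subgroup {U \<in> Bij (carrier H). linear_isometry H H U} (BijGroup (carrier H))"
  proof (rule B.subgroupI)
    show "{U \<in> Bij (carrier H). linear_isometry H H U} \<subseteq> carrier (BijGroup (carrier H))"
      by (auto simp: BijGroup_def)
    have "linear_isometry H H (\<lambda>x\<in>carrier H. x)"
      by (auto simp: linear_isometry_def)
    then show "{U \<in> Bij (carrier H). linear_isometry H H U} \<noteq> {}"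
      using id_Bij by blast
  next
    fix U assume U: "U \<in> {U \<in> Bij (carrier H). linear_isometry H H U}"
    define W where "W = (\<lambda>x\<in>carrier H. inv_into (carrier H) U x)"
    have W: "inv\<^bsub>BijGroup (carrier H)\<^esub> U = W" "W \<in> Bij (carrier H)"
      using U by (simp_all add: inv_BijGroup W_def restrict_inv_into_Bij)
    have U': "linear_isometry H H U" "U ` carrier H = carrier H" "inj_on U (carrier H)"
      using U by (auto simp: Bij_def bij_betw_def)
    have WU: "W (U x) = x" if "x \<in> carrier H" for x
      using that U' by (auto simp: W_def linear_isometryD(1))
    have "linear_isometry H H W"
      unfolding linear_isometry_def
    proof (intro conjI ballI allI)
      show "W \<in> carrier H \<rightarrow> carrier H" using W(2) by (rule Bij_imp_funcset)
    next
      fix x y assume "x \<in> carrier H" "y \<in> carrier H"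
      then obtain u v where uv: "x = U u" "y = U v" "u \<in> carrier H" "v \<in> carrier H"
        using U'(2) by blast
      show "W (x \<oplus>\<^bsub>H\<^esub> y) = W x \<oplus>\<^bsub>H\<^esub> W y"
        using uv WU linear_isometryD(2)[OF U'(1), of u v] by (metis H.M.add.m_closed)
      show "cinner H (W x) (W y) = cinner H x y"
        using uv WU linear_isometryD(4)[OF U'(1), of u v] by simp
    next
      fix c x assume "x \<in> carrier H"
      then obtain u where u: "x = U u" "u \<in> carrier H" using U'(2) by blast
      show "W (c \<odot>\<^bsub>H\<^esub> x) = c \<odot>\<^bsub>H\<^esub> W x"
        using u WU linear_isometryD(3)[OF U'(1), of u c] by (metis H.smult_in)
    qed
    then show "inv\<^bsub>BijGroup (carrier H)\<^esub> U \<in> {U \<in> Bij (carrier H). linear_isometry H H U}"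
      using W by simp
  next
    fix U V assume UV: "U \<in> {U \<in> Bij (carrier H). linear_isometry H H U}"
      "V \<in> {U \<in> Bij (carrier H). linear_isometry H H U}"
    then have "linear_isometry H H (\<lambda>x. U (V x))"
      by (auto simp: linear_isometry_def Pi_iff)
    then have "linear_isometry H H (compose (carrier H) U V)"
      by (rule linear_isometry_cong[OF assms]) (simp add: compose_eq)
    then show "U \<otimes>\<^bsub>BijGroup (carrier H)\<^esub> V \<in> {U \<in> Bij (carrier H). linear_isometry H H U}"
      using UV by (simp add: B1 compose_Bij)
  qed
  then show ?thesis
    unfolding unitary_group_def by (rule B.subgroup_imp_group)
qed

lemma op_tensor_unitary:
  assumes H: "inner_product_space H" and K: "inner_product_space K"
    and A: "A \<in> carrier (unitary_group H)" and B: "B \<in> carrier (unitary_group K)"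
  shows "op_tensor H K A B \<in> carrier (unitary_group (hilbert_tensor H K))"
proof -
  interpret H: inner_product_space H by fact
  interpret K: inner_product_space K by fact
  interpret UH: group "unitary_group H" by (rule group_unitary_group) unfold_locales
  interpret UK: group "unitary_group K" by (rule group_unitary_group) unfold_locales
  define A' where "A' = inv\<^bsub>unitary_group H\<^esub> A"
  define B' where "B' = inv\<^bsub>unitary_group K\<^esub> B"
  have A': "A' \<in> carrier (unitary_group H)" and B': "B' \<in> carrier (unitary_group K)"
    using A B by (simp_all add: A'_def B'_def)
  note iso = A B A' B'
  have AA': "A (A' x) = x" "A' (A x) = x" if "x \<in> carrier H" for x
    using UH.r_inv[OF A] UH.l_inv[OF A] that iso unfolding A'_def[symmetric]
    by (auto simp: unitary_group_simps compose_def fun_eq_iff) (metis restrict_apply')+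
  have BB': "B (B' x) = x" "B' (B x) = x" if "x \<in> carrier K" for x
    using UK.r_inv[OF B] UK.l_inv[OF B] that iso unfolding B'_def[symmetric]
    by (auto simp: unitary_group_simps compose_def fun_eq_iff) (metis restrict_apply')+
  have idH: "linear_isometry H H (\<lambda>x. x)" and idK: "linear_isometry K K (\<lambda>x. x)"
    by (auto simp: linear_isometry_def)
  have li: "linear_isometry H H A" "linear_isometry K K B" "linear_isometry H H A'" "linear_isometry K K B'"
    using iso by (auto simp: unitary_group_simps)
  let ?T = "carrier (hilbert_tensor H K)"
  have "bij_betw (op_tensor H K A B) ?T ?T"
  proof (rule bij_betw_byWitness[where f' = "op_tensor H K A' B'"])
    show "\<forall>S\<in>?T. op_tensor H K A' B' (op_tensor H K A B S) = S"
      using op_tensor_compose[OF H K li(3,4,1,2) idH idK] op_tensor_id[OF H K idH idK] AA' BB' by simp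
    show "\<forall>S\<in>?T. op_tensor H K A B (op_tensor H K A' B' S) = S"
      using op_tensor_compose[OF H K li(1,2,3,4) idH idK] op_tensor_id[OF H K idH idK] AA' BB' by simp
  qed (use li linear_isometryD(1)[OF linear_isometry_op_tensor[OF H K]] in blast)+
  moreover have "op_tensor H K A B \<in> extensional ?T"
    by (simp add: op_tensor_def completion_map_def hilbert_tensor_def)
  ultimately show ?thesis
    using li linear_isometry_op_tensor[OF H K] by (simp add: unitary_group_simps Bij_def)
qed

theorem unitary_rep_phi_tensor:
  assumes "unitary_rep (free_group n) H \<pi>" "unitary_rep (free_group m) K \<pi>'"
  shows "unitary_rep (free_group (n * m)) (hilbert_tensor H K) (phi_tensor n m H K \<pi> \<pi>')"
proof -
  interpret H: hilbert_space H using assms by (simp add: unitary_rep_def)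
  interpret K: hilbert_space K using assms by (simp add: unitary_rep_def)
  note HK = H.inner_product_space_axioms K.inner_product_space_axioms
  have p: "\<pi> \<in> hom (free_group n) (unitary_group H)" "\<pi>' \<in> hom (free_group m) (unitary_group K)"
    using assms by (auto simp: unitary_rep_def)
  have cl: "\<pi> (fst (phi_hom n m g)) \<in> carrier (unitary_group H)"
    "\<pi>' (snd (phi_hom n m g)) \<in> carrier (unitary_group K)"
    "fst (phi_hom n m g) \<in> carrier (free_group n)" "snd (phi_hom n m g) \<in> carrier (free_group m)"
    if "g \<in> carrier (free_group (n * m))" for g
    using hom_in_carrier[OF phi_hom_hom that] p hom_in_carrier by (fastforce simp: DirProd_def)+
  have "phi_tensor n m H K \<pi> \<pi>' \<in> hom (free_group (n * m)) (unitary_group (hilbert_tensor H K))"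
  proof (rule homI)
    fix g assume "g \<in> carrier (free_group (n * m))"
    then show "phi_tensor n m H K \<pi> \<pi>' g \<in> carrier (unitary_group (hilbert_tensor H K))"
      unfolding phi_tensor_def by (intro op_tensor_unitary HK cl)
  next
    fix g h assume g: "g \<in> carrier (free_group (n * m))" and h: "h \<in> carrier (free_group (n * m))"
    let ?F = "free_group (n * m)" and ?T = "hilbert_tensor H K"
    interpret F: group ?F by (rule group_free_group)
    have gh: "g \<otimes>\<^bsub>?F\<^esub> h \<in> carrier ?F" using g h by simp
    have ph: "phi_hom n m (g \<otimes>\<^bsub>?F\<^esub> h) =
        (fst (phi_hom n m g) \<otimes>\<^bsub>free_group n\<^esub> fst (phi_hom n m h),
         snd (phi_hom n m g) \<otimes>\<^bsub>free_group m\<^esub> snd (phi_hom n m h))"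
      using hom_mult[OF phi_hom_hom g h] by (simp add: DirProd_def split_beta)
    have A: "\<pi> (fst (phi_hom n m (g \<otimes>\<^bsub>?F\<^esub> h))) x = \<pi> (fst (phi_hom n m g)) (\<pi> (fst (phi_hom n m h)) x)"
      if "x \<in> carrier H" for x
      using that cl[OF g] cl[OF h] hom_mult[OF p(1)] unfolding ph
      by (simp add: unitary_group_simps compose_eq)
    have B: "\<pi>' (snd (phi_hom n m (g \<otimes>\<^bsub>?F\<^esub> h))) x = \<pi>' (snd (phi_hom n m g)) (\<pi>' (snd (phi_hom n m h)) x)"
      if "x \<in> carrier K" for x
      using that cl[OF g] cl[OF h] hom_mult[OF p(2)] unfolding ph
      by (simp add: unitary_group_simps compose_eq)
    have u: "phi_tensor n m H K \<pi> \<pi>' k \<in> Bij (carrier ?T)" if "k \<in> carrier ?F" for k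
      using op_tensor_unitary[OF HK cl(1,2)[OF that]] by (simp add: phi_tensor_def unitary_group_simps)
    have li: "linear_isometry H H (\<pi> (fst (phi_hom n m k)))" "linear_isometry K K (\<pi>' (snd (phi_hom n m k)))"
      if "k \<in> carrier ?F" for k
      using cl[OF that] by (auto simp: unitary_group_simps)
    have "phi_tensor n m H K \<pi> \<pi>' (g \<otimes>\<^bsub>?F\<^esub> h) =
        compose (carrier ?T) (phi_tensor n m H K \<pi> \<pi>' g) (phi_tensor n m H K \<pi> \<pi>' h)"
    proof (rule extensionalityI)
      show "phi_tensor n m H K \<pi> \<pi>' (g \<otimes>\<^bsub>?F\<^esub> h) \<in> extensional (carrier ?T)"
        using u[OF gh] by (rule Bij_imp_extensional)
      fix S assume "S \<in> carrier ?T"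
      then show "phi_tensor n m H K \<pi> \<pi>' (g \<otimes>\<^bsub>?F\<^esub> h) S =
          compose (carrier ?T) (phi_tensor n m H K \<pi> \<pi>' g) (phi_tensor n m H K \<pi> \<pi>' h) S"
        using op_tensor_compose[OF HK li[OF g] li[OF h] li[OF gh] A B, symmetric]
        by (simp add: compose_eq phi_tensor_def)
    qed simp
    then show "phi_tensor n m H K \<pi> \<pi>' (g \<otimes>\<^bsub>?F\<^esub> h) =
        phi_tensor n m H K \<pi> \<pi>' g \<otimes>\<^bsub>unitary_group ?T\<^esub> phi_tensor n m H K \<pi> \<pi>' h"
      using u[OF g] u[OF h] by (simp add: unitary_group_simps)
  qed
  then show ?thesis
    by (simp add: unitary_rep_def hilbert_space_hilbert_tensor[OF HK])
qed

end

theory Submission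
  imports Defs
begin

text \<open>One-dimensional representations suffice. Let \<open>n = m = 2\<close>, let \<open>\<pi>\<^sub>1\<close> be trivial and let \<open>\<pi>\<^sub>2\<close> be
  the character that maps the first generator to \<open>1\<close> and the second one to \<open>-1\<close>. The second generator
  of the free group of rank 4 corresponds to the pair of the first and the second generator, so it
  acts as \<open>-1\<close> on one side and as the identity on the other.\<close>

text \<open>The Hilbert space of complex numbers, modelled as sequences supported at index 0 because
  the theorem fixes \<open>nat \<Rightarrow> complex\<close> as the type of vectors.\<close>

definition complex_line :: "(nat \<Rightarrow> complex) inner_space" where
  "complex_line = \<lparr>carrier = {x. \<forall>k>0. x k = 0}, monoid.mult = undefined, one = undefined,
     ring.zero = (\<lambda>k. 0), add = (\<lambda>x y k. x k + y k), smult = (\<lambda>c x k. c * x k),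
     cinner = (\<lambda>x y. x 0 * cnj (y 0))\<rparr>"

lemma complex_line_simps [simp]:
  "x \<in> carrier complex_line \<longleftrightarrow> (\<forall>k>0. x k = 0)"
  "\<zero>\<^bsub>complex_line\<^esub> = (\<lambda>k. 0)"
  "x \<oplus>\<^bsub>complex_line\<^esub> y = (\<lambda>k. x k + y k)"
  "c \<odot>\<^bsub>complex_line\<^esub> x = (\<lambda>k. c * x k)"
  "cinner complex_line x y = x 0 * cnj (y 0)"
  by (simp_all add: complex_line_def)

lemma inner_product_space_complex_line: "inner_product_space complex_line"
proof -
  have "abelian_group complex_line"
  proof (rule abelian_groupI)
    fix x assume "x \<in> carrier complex_line"
    then show "\<exists>y\<in>carrier complex_line. y \<oplus>\<^bsub>complex_line\<^esub> x = \<zero>\<^bsub>complex_line\<^esub>"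
      by (intro bexI[of _ "\<lambda>k. - x k"]) simp_all
  qed (simp_all add: algebra_simps)
  then have "module complex_field complex_line"
    by (intro module.intro module_axioms.intro cring_complex_field) (simp_all add: algebra_simps)
  then have "semi_inner_space complex_line"
    by (intro semi_inner_space.intro semi_inner_space_axioms.intro) (simp_all add: algebra_simps)
  moreover have "x = \<zero>\<^bsub>complex_line\<^esub>"
    if "x \<in> carrier complex_line" "cinner complex_line x x = 0" for x
  proof
    fix k
    show "x k = \<zero>\<^bsub>complex_line\<^esub> k"
      \<comment> \<open>Coordinate 0 vanishes because its squared modulus does, the others by
        membership in the carrier.\<close>
      using that by (cases k) simp_all
  qed
  ultimately show ?thesis
    by (intro inner_product_space.intro inner_product_space_axioms.intro)
qed

lemma cnorm_complex_line: "cnorm complex_line x = cmod (x 0)"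
  by (simp add: cnorm_def cmod_def power2_eq_square)

text \<open>Evaluation at 0 is an isometry from the carrier onto the complex numbers, so
  completeness is inherited from there.\<close>

lemma hilbert_space_complex_line: "hilbert_space complex_line"
proof -
  interpret L: inner_product_space complex_line by (rule inner_product_space_complex_line)
  interpret M: Metric_space "carrier complex_line" "cdist complex_line"
    by (rule L.cdist_Metric_space)
  have dist: "cdist complex_line x y = dist (x 0) (y 0)"
    if "x \<in> carrier complex_line" "y \<in> carrier complex_line" for x y
  proof -
    have "(x \<ominus>\<^bsub>complex_line\<^esub> y) 0 = x 0 - y 0"
      using that by (simp add: L.minus_eq_smult del: complex_line_simps(1))
    then show ?thesis
      using that by (simp add: L.cdist_eq cnorm_complex_line dist_norm del: complex_line_simps(1))
  qed
  have "M.mcomplete"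
    unfolding M.mcomplete_def
  proof (intro allI impI)
    fix s assume s: "M.MCauchy s"
    then have sc: "s n \<in> carrier complex_line" for n
      unfolding M.MCauchy_def by blast
    have "Cauchy (\<lambda>n. s n 0)"
      using s by (simp add: M.MCauchy_def Cauchy_def dist sc del: complex_line_simps(1))
    then obtain z where z: "(\<lambda>n. s n 0) \<longlonglongrightarrow> z"
      using Cauchy_convergent convergent_def by blast
    \<comment> \<open>Extending the scalar limit by zero keeps it in the carrier.\<close>
    define l where "l = (\<lambda>k::nat. if k = 0 then z else 0)"
    have l: "l \<in> carrier complex_line" "l 0 = z"
      by (simp_all add: l_def)
    have "limitin M.mtopology s l sequentially"
      using z l by (simp add: M.limit_metric_sequentially LIMSEQ_def dist sc del: complex_line_simps(1))
    then show "\<exists>l. limitin M.mtopology s l sequentially" by blast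
  qed
  then show ?thesis
    by (simp add: hilbert_space_def hilbert_space_axioms_def inner_product_space_complex_line)
qed

text \<open>Restricted to the carrier since elements of \<open>Bij\<close> must be
  extensional.\<close>

definition scalar_op :: "complex \<Rightarrow> (nat \<Rightarrow> complex) \<Rightarrow> nat \<Rightarrow> complex" where
  "scalar_op c = (\<lambda>x\<in>carrier complex_line. c \<odot>\<^bsub>complex_line\<^esub> x)"

text \<open>Scaling by \<open>inverse c\<close> is the two-sided inverse, and
  \<open>c * cnj c = 1\<close> preserves the inner product.\<close>

lemma scalar_op_unitary:
  assumes "cmod c = 1"
  shows "scalar_op c \<in> carrier (unitary_group complex_line)"
proof -
  have c: "c * cnj c = 1" "c \<noteq> 0"
    using assms by (auto simp: complex_norm_square[symmetric])
  have "bij_betw (scalar_op c) (carrier complex_line) (carrier complex_line)"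
    by (rule bij_betw_byWitness[where f' = "scalar_op (inverse c)"])
      (use c in \<open>auto simp: scalar_op_def\<close>)
  moreover have "linear_isometry complex_line complex_line (scalar_op c)"
    using c by (auto simp: linear_isometry_def scalar_op_def algebra_simps)
  ultimately show ?thesis
    by (simp add: unitary_group_simps Bij_def scalar_op_def)
qed

text \<open>By the universal property of the free group, the generators may be sent to arbitrary
  unitaries.\<close>

lemma unitary_rep_free_lift:
  assumes "hilbert_space H" "\<And>i. 1 \<le> i \<Longrightarrow> i \<le> n \<Longrightarrow> f i \<in> carrier (unitary_group H)"
  shows "unitary_rep (free_group n) H (free_lift (unitary_group H) f)"
proof -
  interpret hilbert_space H by fact
  show ?thesis
    using assms free_lift_hom[OF group_unitary_group[OF semi_inner_space_axioms]]
    by (simp add: unitary_rep_def)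
qed

theorem fact3p1:
  shows "\<exists>(n::nat) (m::nat). n \<ge> 2 \<and> m \<ge> 2 \<and>
    (\<exists>(H\<^sub>1 :: (nat \<Rightarrow> complex) inner_space) (H\<^sub>2 :: (nat \<Rightarrow> complex) inner_space)
        (\<pi>\<^sub>1 :: letter list \<Rightarrow> (nat \<Rightarrow> complex) \<Rightarrow> (nat \<Rightarrow> complex))
        (\<pi>\<^sub>2 :: letter list \<Rightarrow> (nat \<Rightarrow> complex) \<Rightarrow> (nat \<Rightarrow> complex)).
      unitary_rep (free_group n) H\<^sub>1 \<pi>\<^sub>1 \<and>
      unitary_rep (free_group m) H\<^sub>2 \<pi>\<^sub>2 \<and>
      unitary_rep (free_group (n * m)) (hilbert_tensor H\<^sub>1 H\<^sub>2) (phi_tensor n m H\<^sub>1 H\<^sub>2 \<pi>\<^sub>1 \<pi>\<^sub>2) \<and>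
      unitary_rep (free_group (n * m)) (hilbert_tensor H\<^sub>2 H\<^sub>1) (phi_tensor m n H\<^sub>2 H\<^sub>1 \<pi>\<^sub>2 \<pi>\<^sub>1) \<and>
      \<not> unitarily_equivalent (free_group (n * m))
          (hilbert_tensor H\<^sub>1 H\<^sub>2) (phi_tensor n m H\<^sub>1 H\<^sub>2 \<pi>\<^sub>1 \<pi>\<^sub>2)
          (hilbert_tensor H\<^sub>2 H\<^sub>1) (phi_tensor m n H\<^sub>2 H\<^sub>1 \<pi>\<^sub>2 \<pi>\<^sub>1))"
proof -
  note L = inner_product_space_complex_line
  interpret L: inner_product_space complex_line by (rule L)
  interpret U: group "unitary_group complex_line"
    by (rule group_unitary_group) unfold_locales
  let ?L = complex_line
  define f\<^sub>1 :: "nat \<Rightarrow> (nat \<Rightarrow> complex) \<Rightarrow> nat \<Rightarrow> complex" where "f\<^sub>1 = (\<lambda>_. scalar_op 1)"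
  \<comment> \<open>The default -1 at indices outside 1 and 2 is unitary as well, so
    \<open>f\<close> below holds for every index.\<close>
  define f\<^sub>2 :: "nat \<Rightarrow> (nat \<Rightarrow> complex) \<Rightarrow> nat \<Rightarrow> complex"
    where "f\<^sub>2 = (\<lambda>i. scalar_op (if i = 1 then 1 else -1))"
  define \<pi>\<^sub>1 where "\<pi>\<^sub>1 = free_lift (unitary_group ?L) f\<^sub>1"
  define \<pi>\<^sub>2 where "\<pi>\<^sub>2 = free_lift (unitary_group ?L) f\<^sub>2"
  have f: "f\<^sub>1 i \<in> carrier (unitary_group ?L)" "f\<^sub>2 i \<in> carrier (unitary_group ?L)" for i
    unfolding f\<^sub>1_def f\<^sub>2_def by (rule scalar_op_unitary, simp)+
  have reps: "unitary_rep (free_group 2) ?L \<pi>\<^sub>1" "unitary_rep (free_group 2) ?L \<pi>\<^sub>2"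
    unfolding \<pi>\<^sub>1_def \<pi>\<^sub>2_def
    by (rule unitary_rep_free_lift[OF hilbert_space_complex_line], rule f)+
  have gen: "\<pi>\<^sub>1 (free_gen i) = f\<^sub>1 i" "\<pi>\<^sub>2 (free_gen i) = f\<^sub>2 i" if "1 \<le> i" "i \<le> 2" for i
    unfolding \<pi>\<^sub>1_def \<pi>\<^sub>2_def by (rule free_lift_gen[OF U.is_group], (rule f that)+)+
  \<comment> \<open>Index 2 is \<open>m * (i - 1) + j\<close> with \<open>m = 2\<close>,
    \<open>i = 1\<close>, \<open>j = 2\<close>: a pair of distinct generators, so exchanging the
    representations can change the operator. As \<open>n = m\<close>, the same homomorphism serves
    both orders.\<close>
  have phi: "phi_hom 2 2 (free_gen 2) = (free_gen 1, free_gen 2)"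
  proof -
    have "phi_hom 2 2 (free_gen (2 * (1 - 1) + 2)) = (free_gen 1, free_gen 2)"
      by (rule phi_hom_gen) simp_all
    moreover have "2 * (1 - 1) + 2 = (2::nat)" by simp
    ultimately show ?thesis by (simp only:)
  qed
  \<comment> \<open>The sign appears only when \<open>\<pi>\<^sub>2\<close> is the factor evaluated
    at the second generator.\<close>
  have left: "phi_tensor 2 2 ?L ?L \<pi>\<^sub>1 \<pi>\<^sub>2 (free_gen 2) = op_tensor ?L ?L (scalar_op 1) (scalar_op (-1))"
    and right: "phi_tensor 2 2 ?L ?L \<pi>\<^sub>2 \<pi>\<^sub>1 (free_gen 2) = op_tensor ?L ?L (scalar_op 1) (scalar_op 1)"
    by (simp_all add: phi_tensor_def phi gen f\<^sub>1_def f\<^sub>2_def)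
  have iso: "linear_isometry ?L ?L (scalar_op 1)" "linear_isometry ?L ?L (scalar_op (-1))"
    using scalar_op_unitary by (simp_all add: unitary_group_simps)
  define e :: "nat \<Rightarrow> complex" where "e = (\<lambda>k. if k = 0 then 1 else 0)"
  have e: "e \<in> carrier ?L" "scalar_op (-1) e \<in> carrier ?L" "scalar_op 1 e = e"
    "cinner ?L e e = 1" "cinner ?L (scalar_op (-1) e) e = -1"
    by (simp_all add: e_def scalar_op_def)
  \<comment> \<open>Mathematically \<open>t'\<close> is the negative of \<open>t\<close>; the inner
    products of \<open>t'\<close> and of \<open>t\<close> with \<open>t\<close>, namely -1 and 1,
    already distinguish them.\<close>
  define t where "t = elem_tensor ?L ?L e e"
  define t' where "t' = elem_tensor ?L ?L e (scalar_op (-1) e)"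
  have t: "t \<in> carrier (hilbert_tensor ?L ?L)" "t' \<in> carrier (hilbert_tensor ?L ?L)"
    unfolding t_def t'_def by (intro elem_tensor_closed L e)+
  have left_t: "phi_tensor 2 2 ?L ?L \<pi>\<^sub>1 \<pi>\<^sub>2 (free_gen 2) t = t'"
    unfolding left t_def t'_def by (simp only: op_tensor_elem_tensor[OF L L iso e(1) e(1)] e(3))
  have "\<not> unitarily_equivalent (free_group (2 * 2))
      (hilbert_tensor ?L ?L) (phi_tensor 2 2 ?L ?L \<pi>\<^sub>1 \<pi>\<^sub>2)
      (hilbert_tensor ?L ?L) (phi_tensor 2 2 ?L ?L \<pi>\<^sub>2 \<pi>\<^sub>1)"
  proof
    let ?T = "hilbert_tensor ?L ?L"
    assume "unitarily_equivalent (free_group (2 * 2)) ?T (phi_tensor 2 2 ?L ?L \<pi>\<^sub>1 \<pi>\<^sub>2)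
        ?T (phi_tensor 2 2 ?L ?L \<pi>\<^sub>2 \<pi>\<^sub>1)"
    then obtain W where W: "linear_isometry ?T ?T W" "W ` carrier ?T = carrier ?T"
      and intertwines: "\<forall>g\<in>carrier (free_group (2 * 2)). \<forall>x\<in>carrier ?T.
        W (phi_tensor 2 2 ?L ?L \<pi>\<^sub>1 \<pi>\<^sub>2 g x) = phi_tensor 2 2 ?L ?L \<pi>\<^sub>2 \<pi>\<^sub>1 g (W x)"
      unfolding unitarily_equivalent_def by (elim exE conjE) (rule that)
    have "free_gen 2 \<in> carrier (free_group (2 * 2))"
      by (rule free_gen_closed) simp_all
    \<comment> \<open>The intertwining relation at the second generator and the vector
      \<open>t\<close>; the operator on the right is the identity.\<close>
    then have "W t' = op_tensor ?L ?L (scalar_op 1) (scalar_op 1) (W t)"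
      using intertwines t(1) left_t right by metis
    also have "\<dots> = W t"
      by (rule op_tensor_id[OF L L iso(1) iso(1)])
        (use linear_isometryD(1)[OF W(1) t(1)] in \<open>simp_all add: scalar_op_def\<close>)
    \<comment> \<open>Now \<open>W t' = W t\<close>, and since \<open>W\<close> preserves inner
      products, pairing both sides with \<open>W t\<close> yields -1 = 1.\<close>
    finally have "cinner ?T t' t = cinner ?T t t"
      using linear_isometryD(4)[OF W(1) t(2) t(1)] linear_isometryD(4)[OF W(1) t(1) t(1)] by simp
    then show False
      unfolding t_def t'_def by (simp only: cinner_elem_tensor[OF L L] e) simp
  qed
  with reps unitary_rep_phi_tensor[OF reps] unitary_rep_phi_tensor[OF reps(2,1)] show ?thesis
    by (intro exI[of _ "2::nat"] exI[of _ ?L] exI[of _ \<pi>\<^sub>1] exI[of _ \<pi>\<^sub>2] conjI)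
      (rule order_refl | assumption)+
qed

end
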